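(* Let $A_1,\ldots,A_{s-1}$ be subsets of a finite field $\mathbb{F}_q$ and let $\mathbb{X}=[A_1\times\cdots\times A_{s-1}\times\{1\}]\subset\mathbb{P}^{s-1}$. Suppose $d_i=|A_i|$ for $i=1,\ldots,s-1$ and $2\leq d_1\leq\cdots\leq d_{s-1}$. Let $d\geq 1$ be an integer. Then $$ \delta_\mathbb{X}(d,2)=\left\{ \begin{array}{ll} (d_{k+1}-\ell+1)\,d_{k+2}\cdots d_{s-1}-d_{k+3}\cdots d_{s-1}&\mbox{if } k<s-3,\\ (d_{k+1}-\ell+1)\,d_{k+2}\cdots d_{s-1}-1&\mbox{if } k=s-3,\\ d_{s-1}-\ell+1&\mbox{if } k=s-2,\\ 2&\mbox{if } d\geq\sum_{i=1}^{s-1}(d_i-1), \end{array}\right. $$ where in the first three cases $0\leq k\leq s-2$ and $\ell$ are the integers such that $d=\sum_{i=1}^{k}(d_i-1)+\ell$ and $1\leq\ell\leq d_{k+1}-1$ (such $k,\ell$ exist, and are unique, exactly when $1\le d\leq\sum_{i=1}^{s-1}(d_i-1)$).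
   Context: $\mathbb{P}^{s-1}$ is the projective space over $K=\mathbb{F}_q$ and $[A_1\times\cdots\times A_{s-1}\times\{1\}]$ is the set of classes $[(x_1,\ldots,x_{s-1},1)]$ with $x_i\in A_i$. Write $\mathbb{X}=\{[P_1],\ldots,[P_m]\}$, $m=|\mathbb{X}|$, with representatives $P_i$ whose last entry is $1$. Let $S=K[t_1,\ldots,t_s]$ with the standard grading. $C_\mathbb{X}(d)$ is the image of the $K$-linear map $S_d\to K^m$, $f\mapsto(f(P_1),\ldots,f(P_m))$ (an affine cartesian code). For a linear subspace $D\subset K^m$, $\chi(D)=\{i : \exists (a_1,\ldots,a_m)\in D,\ a_i\neq 0\}$. The second generalized Hamming weight is $\delta_\mathbb{X}(d,2)=\min\{|\chi(D)| : D\subset C_\mathbb{X}(d)\mbox{ a linear subspace},\ \dim_K D=2\}$. *)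

theory Defs
  imports Complex_Main "HOL-Library.Function_Algebras" "HOL-Library.Poly_Mapping"
begin

text \<open>A vector of $K^n$ is a function on the indices $1, \ldots, n$, extended by 0 to all of
  \<open>nat\<close>, so that equality of vectors is equality of functions.\<close>

definition coord_space :: "nat \<Rightarrow> (nat \<Rightarrow> 'a::field) set" where
  "coord_space n = {v. \<forall>i. i \<notin> {1..n} \<longrightarrow> v i = 0}"

definition vscale :: "'a::field \<Rightarrow> (nat \<Rightarrow> 'a) \<Rightarrow> nat \<Rightarrow> 'a" where
  "vscale c v = (\<lambda>i. c * v i)"

global_interpretation coord: vector_space "vscale :: 'a::field \<Rightarrow> (nat \<Rightarrow> 'a) \<Rightarrow> nat \<Rightarrow> 'a"
  by unfold_locales (simp_all add: vscale_def fun_eq_iff algebra_simps)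

lemma subspace_coord_space: "coord.subspace (coord_space n :: (nat \<Rightarrow> 'a::field) set)"
  by (simp add: coord.subspace_def coord_space_def vscale_def)

definition proj_rel :: "nat \<Rightarrow> ((nat \<Rightarrow> 'a::field) \<times> (nat \<Rightarrow> 'a)) set" where
  "proj_rel s = {(x, y). x \<in> coord_space s - {0} \<and> y \<in> coord_space s - {0} \<and>
                         (\<exists>c. c \<noteq> 0 \<and> y = vscale c x)}"

text \<open>\<open>proj_space s\<close> has dimension $s - 1$: it is $\mathbb{P}^{s-1}$.\<close>

definition proj_space :: "nat \<Rightarrow> (nat \<Rightarrow> 'a::field) set set" where
  "proj_space s = (coord_space s - {0}) // proj_rel s"

definition proj_point :: "nat \<Rightarrow> (nat \<Rightarrow> 'a::field) \<Rightarrow> (nat \<Rightarrow> 'a) set" where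
  "proj_point s x = proj_rel s `` {x}"

definition cartesian_points :: "nat \<Rightarrow> (nat \<Rightarrow> 'a::field set) \<Rightarrow> (nat \<Rightarrow> 'a) set set" where
  "cartesian_points s A =
     {proj_point s x | x. x \<in> coord_space s \<and> (\<forall>i\<in>{1..s-1}. x i \<in> A i) \<and> x s = 1}"

lemma equiv_proj_rel: "equiv (coord_space s - {0}) (proj_rel s :: ((nat \<Rightarrow> 'a::field) \<times> _) set)"
proof (rule equivI)
  show "proj_rel s \<subseteq> (coord_space s - {0}) \<times> (coord_space s - {0} :: (nat \<Rightarrow> 'a) set)"
    unfolding proj_rel_def by blast
  show "refl_on (coord_space s - {0}) (proj_rel s :: ((nat \<Rightarrow> 'a) \<times> _) set)"
  proof (rule refl_onI)
    fix x :: "nat \<Rightarrow> 'a"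
    assume "x \<in> coord_space s - {0}"
    moreover have "x = vscale 1 x" "(1::'a) \<noteq> 0" by simp_all
    ultimately show "(x, x) \<in> proj_rel s" unfolding proj_rel_def by blast
  qed
  show "sym (proj_rel s :: ((nat \<Rightarrow> 'a) \<times> _) set)"
  proof (rule symI)
    fix x y :: "nat \<Rightarrow> 'a"
    assume "(x, y) \<in> proj_rel s"
    then obtain c where c: "x \<in> coord_space s - {0}" "y \<in> coord_space s - {0}"
      "c \<noteq> 0" "y = vscale c x"
      unfolding proj_rel_def by blast
    have "x = vscale (inverse c) y" "inverse c \<noteq> 0"
      using c(3) unfolding c(4) by simp_all
    with c(1,2) show "(y, x) \<in> proj_rel s"
      unfolding proj_rel_def by blast
  qed
  show "trans (proj_rel s :: ((nat \<Rightarrow> 'a) \<times> _) set)"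
  proof (rule transI)
    fix x y z :: "nat \<Rightarrow> 'a"
    assume xy: "(x, y) \<in> proj_rel s" and yz: "(y, z) \<in> proj_rel s"
    obtain b where b: "x \<in> coord_space s - {0}" "b \<noteq> 0" "y = vscale b x"
      using xy unfolding proj_rel_def by blast
    obtain c where c: "z \<in> coord_space s - {0}" "c \<noteq> 0" "z = vscale c y"
      using yz unfolding proj_rel_def by blast
    have "z = vscale (c * b) x" "c * b \<noteq> 0"
      using b(2) c(2) unfolding c(3) b(3) by simp_all
    with b(1) c(1) show "(x, z) \<in> proj_rel s"
      unfolding proj_rel_def by blast
  qed
qed

lemma cartesian_points_subset: "cartesian_points s A \<subseteq> proj_space s"
proof
  fix p assume "p \<in> cartesian_points s A"
  then obtain x where x: "x \<in> coord_space s" "x s = 1" "p = proj_rel s `` {x}"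
    by (auto simp: cartesian_points_def proj_point_def)
  have "x \<noteq> 0" using x(2) by auto
  then show "p \<in> proj_space s" using x by (auto simp: proj_space_def intro: quotientI)
qed

text \<open>Polynomials in $t_1, t_2, \ldots$ over $K$ are finitely supported maps from exponent vectors
  to coefficients; the exponent vectors of $S = K[t_1, \ldots, t_s]$ are supported in
  $\{1, \ldots, s\}$. Thus \<open>homogeneous_part s d\<close> is $S_d$, including 0.\<close>

definition homogeneous_part :: "nat \<Rightarrow> nat \<Rightarrow> ((nat \<Rightarrow>\<^sub>0 nat) \<Rightarrow>\<^sub>0 'a::field) set" where
  "homogeneous_part s d =
     {f. \<forall>t\<in>Poly_Mapping.keys f. Poly_Mapping.keys t \<subseteq> {1..s} \<and>
           (\<Sum>i\<in>Poly_Mapping.keys t. Poly_Mapping.lookup t i) = d}"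

definition poly_eval :: "((nat \<Rightarrow>\<^sub>0 nat) \<Rightarrow>\<^sub>0 'a::field) \<Rightarrow> (nat \<Rightarrow> 'a) \<Rightarrow> 'a" where
  "poly_eval f x = (\<Sum>t\<in>Poly_Mapping.keys f. Poly_Mapping.lookup f t *
                      (\<Prod>i\<in>Poly_Mapping.keys t. x i ^ Poly_Mapping.lookup t i))"

text \<open>The evaluation code in $K^m$ of degree \<open>d\<close> at the representatives $P_1, \ldots, P_m$.\<close>

definition eval_code ::
    "nat \<Rightarrow> nat \<Rightarrow> (nat \<Rightarrow> nat \<Rightarrow> 'a::field) \<Rightarrow> nat \<Rightarrow> (nat \<Rightarrow> 'a) set" where
  "eval_code s m P d =
     (\<lambda>f i. if i \<in> {1..m} then poly_eval f (P i) else 0) ` homogeneous_part s d"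

lemma eval_code_subset: "eval_code s m P d \<subseteq> coord_space m"
  by (auto simp: eval_code_def coord_space_def)

definition code_support :: "nat \<Rightarrow> (nat \<Rightarrow> 'a::field) set \<Rightarrow> nat set" where
  "code_support m D = {i \<in> {1..m}. \<exists>a\<in>D. a i \<noteq> 0}"

definition gen_hamming_weight :: "nat \<Rightarrow> (nat \<Rightarrow> 'a::field) set \<Rightarrow> nat \<Rightarrow> nat" where
  "gen_hamming_weight m C r =
     Min {card (code_support m D) | D. D \<subseteq> C \<and> coord.subspace D \<and> coord.dim D = r}"

end

theory Submission
  imports Defs "HOL-Library.FuncSet"
begin

text \<open>
  Write $n = s - 1$ and $e_i = |A_i|$. Normalising the last coordinate to 1 turns $\mathbb{X}$ into
  the affine grid $A_1 \times \cdots \times A_n$, and forms of degree $d$ in $s$ variables into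
  polynomials of degree at most $d$ in $n$ variables. For an exponent $a$ in the box
  $\prod_i \{0, \ldots, e_i - 1\}$ call the set of exponents of the box that dominate $a$
  coordinatewise the quadrant of $a$. The proof shows that the second generalized Hamming weight is
  the least size of a union of two quadrants of distinct exponents of degree at most $d$, and then
  computes that minimum.

  Lower bound: let $D$ be a two-dimensional subcode and $Z$ its set of common zeros. Gaussian
  elimination yields two elements of $D$ with distinct leading exponents $a \neq b$ in the box
  (\<open>two_leading_terms\<close>). On $Z$ every monomial in the quadrant of $a$ or of $b$ is a combination of
  smaller monomials, so the monomials outside both quadrants span the functions on $Z$
  (\<open>footprint_bound\<close>). Hence $|Z|$ is at most the number of exponents outside the two quadrants, and
  the support of $D$ is at least as large as their union (\<open>support_ge_quadrants\<close>).

  Upper bound: after numbering each $A_i$ by $0, \ldots, e_i - 1$, the product over $i$ of the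
  linear factors that vanish at the first $a_i$ elements of $A_i$ has degree $|a|$ and is nonzero
  exactly on the quadrant of $a$. Two such products span a code whose support is the union of the two
  quadrants (\<open>quadrants_attained\<close>).

  Minimum: by inclusion and exclusion the union of two quadrants has
  $\prod (e_i - a_i) + \prod (e_i - b_i) - \prod (e_i - \max(a_i, b_i))$ elements. Slicing along the
  first, shortest side shows by induction that nothing beats the greedy choice, which exhausts the
  short sides first (\<open>union_min_le\<close>, \<open>union_min_attained\<close>); the formula of the theorem is the value
  of that choice.
\<close>

section \<open>The smallest union of two quadrants of a box\<close>



text \<open>The size of the quadrant of the greedy exponent, which spends the degree \<open>d\<close> on the sides of the
  box \<open>L\<close> from left to right and stops at the top corner. A full side \<open>c\<close> costs \<open>c - 1\<close> and leaves a
  single slice.\<close>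

fun quadrant_min :: "nat list \<Rightarrow> nat \<Rightarrow> int" where
  "quadrant_min [] d = 1"
| "quadrant_min (c # L) d =
     (if d < c then (int c - int d) * int (prod_list L) else quadrant_min L (d - (c - 1)))"

text \<open>The number of points of the box \<open>L\<close> whose first coordinate is 0, with value 0 if there is no first
  coordinate. It is what the lowest slice of the greedy union lacks.\<close>

fun corner :: "nat list \<Rightarrow> nat" where
  "corner [] = 0"
| "corner (c # L) = prod_list L"

text \<open>The size of the union for the greedy pair. If the degree runs out in the side \<open>c\<close>, the first
  exponent has \<open>d\<close> there, and the second has \<open>d - 1\<close> there and 1 in the next side. Then the slices
  from \<open>d\<close> on are covered completely, and of slice \<open>d - 1\<close> only the points with next coordinate 0
  are missing. Without a next side the second exponent just drops one degree and nothing is missing.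
  The value 2 for the empty list is the case in which every side can be exhausted: the pair then
  consists of the top corner and a neighbour of it.\<close>

fun union_min :: "nat list \<Rightarrow> nat \<Rightarrow> int" where
  "union_min [] d = 2"
| "union_min (c # L) d =
     (if d < c then (int c - int d + 1) * int (prod_list L) - int (corner L)
      else union_min L (d - (c - 1)))"

lemma quadrant_min_0: "\<forall>c\<in>set L. 1 \<le> c \<Longrightarrow> quadrant_min L 0 = int (prod_list L)"
  by (cases L) auto

lemma corner_bound:
  assumes "sorted (c # L)" and "1 \<le> c"
  shows "c * corner L \<le> prod_list L"
  using assms by (cases L) auto

text \<open>Starting at height \<open>c - t\<close> in the first side leaves \<open>t\<close> slices, each with the remaining degree
  \<open>d - (c - t)\<close>. Going as high as possible instead is at least as good: within one side the
  product \<open>t * m\<close> is compared with \<open>m + t - 1\<close>, and where the remaining degree spills into the next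
  side, that side is at least as long as \<open>c\<close>. If both degrees lie beyond the next side, the claim is
  the same claim one side further on.\<close>

lemma quadrant_min_step:
  assumes "sorted (c # L)" and "1 \<le> c" and "1 \<le> t" and "t \<le> c" and "c \<le> d + t"
  shows "quadrant_min (c # L) d \<le> int t * quadrant_min L (d + t - c)"
  using assms
proof (induction L arbitrary: c d)
  case Nil
  then show ?case by auto
next
  case (Cons b L)
  have b: "c \<le> b" "sorted (b # L)" using Cons.prems by auto
  define p where "p = int (prod_list L)"
  have p: "0 \<le> p" by (simp add: p_def)
  define x where "x = d + t - c"
  show ?case
  proof (cases "d < c")
    case True
    have x: "x < b" "int c - int d = int t - int x" using True Cons.prems b by (auto simp: x_def)
    have "(int t - int x) * int b \<le> int t * (int b - int x)"
    proof -
      have "int x * int t \<le> int x * int b" using Cons.prems b by (intro mult_left_mono) auto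
      then show ?thesis by (simp add: algebra_simps)
    qed
    then have "(int t - int x) * int b * p \<le> int t * (int b - int x) * p"
      using p by (rule mult_right_mono)
    moreover have "quadrant_min (c # b # L) d = (int c - int d) * int b * p"
      using True by (simp add: p_def)
    moreover have "quadrant_min (b # L) x = (int b - int x) * p" using x(1) by (simp add: p_def)
    ultimately show ?thesis unfolding x_def[symmetric] x(2) by (simp add: mult.assoc)
  next
    case False
    define y where "y = d - (c - 1)"
    have y: "1 \<le> y" "x = y + t - 1" "x = y + (t - 1)" using False Cons.prems by (auto simp: y_def x_def)
    have l: "quadrant_min (c # b # L) d = quadrant_min (b # L) y" using False by (simp add: y_def)
    show ?thesis
    proof (cases "x < b")
      case True
      define m where "m = int b - int x"
      have m: "1 \<le> m" "int b - int y = m + int t - 1" using True y Cons.prems by (auto simp: m_def)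
      have "0 \<le> (int t - 1) * (m - 1)" using m Cons.prems by simp
      then have "m + int t - 1 \<le> int t * m" by (simp add: algebra_simps)
      then have "(m + int t - 1) * p \<le> int t * m * p" using p by (rule mult_right_mono)
      moreover have "quadrant_min (b # L) x = m * p" using True by (simp add: p_def m_def)
      moreover have "y < b" using True y by linarith
      then have "quadrant_min (b # L) y = (int b - int y) * p" by (simp add: p_def)
      ultimately show ?thesis unfolding l x_def[symmetric] m(2) by (simp add: mult.assoc)
    next
      case False
      have "quadrant_min (b # L) x = quadrant_min L (y + t - b)"
        using False y Cons.prems by (auto intro: arg_cong[where f = "quadrant_min L"])
      moreover have "quadrant_min (b # L) y \<le> int t * quadrant_min L (y + t - b)"
        using False y b Cons.prems by (intro Cons.IH) auto
      ultimately show ?thesis unfolding l x_def[symmetric] by simp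
    qed
  qed
qed

text \<open>The analogue of \<open>quadrant_min_step\<close> for two exponents that agree in the first coordinate.\<close>

lemma union_min_step:
  assumes "sorted (c # L)" and "1 \<le> c" and "1 \<le> t" and "t \<le> c" and "c < d + t" and "1 \<le> d"
  shows "union_min (c # L) d \<le> int t * union_min L (d + t - c)"
  using assms
proof (induction L arbitrary: c d)
  case Nil
  then show ?case by auto
next
  case (Cons b L)
  have b: "c \<le> b" "sorted (b # L)" using Cons.prems by auto
  define p q where "p = int (prod_list L)" and "q = int (corner L)"
  have "b * corner L \<le> prod_list L" using b Cons.prems by (intro corner_bound) auto
  then have bq: "int b * q \<le> p" unfolding p_def q_def by (metis of_nat_le_iff of_nat_mult)
  have q: "0 \<le> q" by (simp add: q_def)
  have "int t * q \<le> int b * q" using Cons.prems b q by (intro mult_right_mono) auto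
  then have tq: "int t * q \<le> p" using bq by simp
  have "1 * q \<le> int t * q" using Cons.prems q by (intro mult_right_mono) auto
  then have qp: "q \<le> p" "0 \<le> p" using tq q by auto
  define x where "x = d + t - c"
  show ?case
  proof (cases "d < c")
    case True
    have x: "x < b" "1 \<le> x" "int c - int d = int t - int x" using True Cons.prems b by (auto simp: x_def)
    have "0 \<le> (int x - 1) * (int b - int t) * p"
      using x Cons.prems b qp by (intro mult_nonneg_nonneg) auto
    then have "(int t - int x + 1) * (int b * p) - p \<le> int t * ((int b - int x + 1) * p - q)"
      using tq by (simp add: algebra_simps)
    moreover have "union_min (c # b # L) d = (int c - int d + 1) * (int b * p) - p"
      using True by (simp add: p_def)
    moreover have "union_min (b # L) x = (int b - int x + 1) * p - q"
      using x(1) by (simp add: p_def q_def)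
    ultimately show ?thesis unfolding x_def[symmetric] x(3) by simp
  next
    case False
    define y where "y = d - (c - 1)"
    have y: "1 \<le> y" "x = y + t - 1" "x = y + (t - 1)" using False Cons.prems by (auto simp: y_def x_def)
    have l: "union_min (c # b # L) d = union_min (b # L) y" using False by (simp add: y_def)
    show ?thesis
    proof (cases "x < b")
      case True
      define m where "m = int b - int x"
      have m: "1 \<le> m" "int b - int y + 1 = m + int t" using True y Cons.prems by (auto simp: m_def)
      have "1 * p \<le> m * p" using m qp by (intro mult_right_mono) auto
      then have "0 \<le> (int t - 1) * (m * p - q)" using Cons.prems qp by (intro mult_nonneg_nonneg) auto
      then have "(m + int t) * p - q \<le> int t * ((m + 1) * p - q)" by (simp add: algebra_simps)
      moreover have "union_min (b # L) x = (m + 1) * p - q"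
        using True by (simp add: p_def m_def q_def)
      moreover have "y < b" using True y by linarith
      then have "union_min (b # L) y = (int b - int y + 1) * p - q"
        by (simp add: p_def q_def)
      ultimately show ?thesis unfolding l x_def[symmetric] m by simp
    next
      case False
      have "union_min (b # L) x = union_min L (y + t - b)"
        using False y Cons.prems by (auto intro: arg_cong[where f = "union_min L"])
      moreover have "union_min (b # L) y \<le> int t * union_min L (y + t - b)"
        using False y b Cons.prems by (intro Cons.IH) auto
      ultimately show ?thesis unfolding l x_def[symmetric] by simp
    qed
  qed
qed

text \<open>The bound for two exponents that differ in the first coordinate: the larger first coordinate is
  \<open>c - t\<close>, the top \<open>t\<close> slices contain at least one quadrant of remaining degree \<open>d - (c - t)\<close>, and
  the slices below amount to at least a quadrant with one more unit of degree. For \<open>d < c\<close>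
  this is sharp at \<open>t = c - d\<close>, where it describes the greedy pair.\<close>

lemma union_min_le_quadrant_min:
  assumes "sorted (c # L)" and "1 \<le> t" and "t < c" and "c \<le> d + t" and "1 \<le> d"
  shows "union_min (c # L) d \<le> quadrant_min L (d + t - c + 1) + int t * quadrant_min L (d + t - c)"
  using assms
proof (induction L arbitrary: c d)
  case Nil
  then show ?case by auto
next
  case (Cons b L)
  have b: "c \<le> b" "sorted (b # L)" using Cons.prems by auto
  define p q where "p = int (prod_list L)" and "q = int (corner L)"
  have q: "0 \<le> q" "0 \<le> p" by (simp_all add: q_def p_def)
  define x where "x = d + t - c"
  show ?case
  proof (cases "d < c")
    case True
    have x: "x + 1 < b" "int c - int d = int t - int x" using True Cons.prems b by (auto simp: x_def)
    have "0 \<le> int x * (int b - 1 - int t) * p"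
      using x Cons.prems b q by (intro mult_nonneg_nonneg) auto
    then have "(int t - int x + 1) * (int b * p) - p
        \<le> (int b - (int x + 1)) * p + int t * ((int b - int x) * p)"
      by (simp add: algebra_simps)
    moreover have "union_min (c # b # L) d = (int c - int d + 1) * (int b * p) - p"
      using True by (simp add: p_def)
    moreover have "quadrant_min (b # L) x = (int b - int x) * p"
      "quadrant_min (b # L) (x + 1) = (int b - (int x + 1)) * p"
      using x(1) by (simp_all add: p_def)
    ultimately show ?thesis unfolding x_def[symmetric] x(2) by simp
  next
    case False
    define y where "y = d - (c - 1)"
    have y: "1 \<le> y" "x = y + t - 1" "x = y + (t - 1)" using False Cons.prems by (auto simp: y_def x_def)
    have l: "union_min (c # b # L) d = union_min (b # L) y" using False by (simp add: y_def)
    show ?thesis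
    proof (cases "x + 1 < b")
      case True
      define m where "m = int b - int x"
      have m: "2 \<le> m" "int b - int y + 1 = m + int t" using True y Cons.prems by (auto simp: m_def)
      have "1 * 1 \<le> int t * (m - 1)" using m Cons.prems by (intro mult_mono) auto
      then have "m + int t \<le> (m - 1) + int t * m" by (simp add: algebra_simps)
      then have "(m + int t) * p \<le> ((m - 1) + int t * m) * p" using q by (intro mult_right_mono) auto
      then have "(m + int t) * p - q \<le> (m - 1) * p + int t * (m * p)"
        using q by (simp add: algebra_simps)
      moreover have "quadrant_min (b # L) x = m * p" "quadrant_min (b # L) (x + 1) = (m - 1) * p"
        using True by (simp_all add: p_def m_def)
      moreover have "y < b" using True y by linarith
      then have "union_min (b # L) y = (int b - int y + 1) * p - q"
        by (simp add: p_def q_def)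
      ultimately show ?thesis unfolding l x_def[symmetric] m by simp
    next
      case False
      have pos: "\<forall>c\<in>set L. 1 \<le> c" using Cons.prems by auto
      have "quadrant_min (b # L) (x + 1) = quadrant_min L (y + t - b + 1)"
        using False y Cons.prems by (auto intro: arg_cong[where f = "quadrant_min L"])
      moreover have "quadrant_min (b # L) x = quadrant_min L (y + t - b)"
      proof (cases "x < b")
        case True
        then have "b = x + 1" using False by simp
        then show ?thesis using y quadrant_min_0[OF pos] by simp
      next
        case False
        then show ?thesis using y Cons.prems by (auto intro: arg_cong[where f = "quadrant_min L"])
      qed
      moreover have "union_min (b # L) y
          \<le> quadrant_min L (y + t - b + 1) + int t * quadrant_min L (y + t - b)"
        using False y b Cons.prems by (intro Cons.IH) auto
      ultimately show ?thesis unfolding l x_def[symmetric] by simp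
    qed
  qed
qed

lemma quadrant_min_le:
  assumes "sorted (map e js)" and "\<forall>j\<in>set js. a j < e j" and "sum_list (map a js) \<le> d"
  shows "quadrant_min (map e js) d \<le> (\<Prod>j\<leftarrow>js. int (e j) - int (a j))"
  using assms
proof (induction js arbitrary: d)
  case Nil
  then show ?case by simp
next
  case (Cons j js)
  have "quadrant_min (map e (j # js)) d \<le> int (e j - a j) * quadrant_min (map e js) (d + (e j - a j) - e j)"
    using Cons.prems quadrant_min_step[of "e j" "map e js" "e j - a j" d] by auto
  also have "d + (e j - a j) - e j = d - a j" using Cons.prems by auto
  also have "int (e j - a j) * quadrant_min (map e js) (d - a j)
      \<le> int (e j - a j) * (\<Prod>j\<leftarrow>js. int (e j) - int (a j))"
    using Cons.prems by (intro mult_left_mono Cons.IH) auto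
  finally show ?case using Cons.prems by (simp add: of_nat_diff)
qed

text \<open>If the exponents agree in the first coordinate, all slices are alike and induction applies. If
  \<open>a j < b j\<close>, the \<open>b j - a j\<close> lower slices meet only the quadrant of \<open>a\<close>, which by
  \<open>quadrant_min_step\<close> is worth a single quadrant of degree \<open>d - b j + 1\<close>, while for the upper slices
  it suffices to count the quadrant of \<open>b\<close>.\<close>

lemma union_min_le:
  assumes "sorted (map e js)" and "\<forall>j\<in>set js. a j < e j \<and> b j < e j"
    and "sum_list (map a js) \<le> d" and "sum_list (map b js) \<le> d" and "\<exists>j\<in>set js. a j \<noteq> b j" and "1 \<le> d"
  shows "union_min (map e js) d \<le> (\<Prod>j\<leftarrow>js. int (e j) - int (a j)) + (\<Prod>j\<leftarrow>js. int (e j) - int (b j))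
      - (\<Prod>j\<leftarrow>js. int (e j) - int (max (a j) (b j)))"
  using assms
proof (induction js arbitrary: d)
  case Nil
  then show ?case by simp
next
  case (Cons j js)
  define c L where "c = e j" and "L = map e js"
  have cL: "sorted (c # L)" using Cons.prems by (simp add: c_def L_def)
  have main: "union_min (c # L) d \<le> (int c - int (a j)) * (\<Prod>j\<leftarrow>js. int (e j) - int (a j))
      + (int c - int (b j)) * (\<Prod>j\<leftarrow>js. int (e j) - int (b j))
      - (int c - int (b j)) * (\<Prod>j\<leftarrow>js. int (e j) - int (max (a j) (b j)))"
    if ab: "a j < b j" and 
      h: "\<forall>j\<in>set js. a j < e j \<and> b j < e j" "a j + sum_list (map a js) \<le> d" "b j + sum_list (map b js) \<le> d"
      "b j < c" for a b
  proof -
    define U V W where "U = (\<Prod>j\<leftarrow>js. int (e j) - int (a j))" and "V = (\<Prod>j\<leftarrow>js. int (e j) - int (b j))"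
      and "W = (\<Prod>j\<leftarrow>js. int (e j) - int (max (a j) (b j)))"
    have U: "quadrant_min L (d - a j) \<le> U" unfolding U_def L_def
      using h Cons.prems(1) by (intro quadrant_min_le) auto
    have V: "quadrant_min L (d - b j) \<le> V" unfolding V_def L_def
      using h Cons.prems(1) by (intro quadrant_min_le) auto
    have "0 \<le> W \<and> W \<le> U" using h(1) unfolding W_def U_def
    proof (induction js)
      case (Cons i js)
      then show ?case by (auto intro!: mult_mono simp: less_imp_le)
    qed simp
    then have W: "W \<le> U" by simp
    \<comment> \<open>A first side of length \<open>c\<close>, filled completely, is put in front of \<open>L\<close>.\<close>
    have "quadrant_min L (d - b j + 1) \<le> int (b j - a j) * quadrant_min L (d - a j)"
    proof -
      have "quadrant_min (c # L) (d - b j + c)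
          \<le> int (b j - a j) * quadrant_min L (d - b j + c + (b j - a j) - c)"
        using cL ab h by (intro quadrant_min_step) auto
      moreover have "d - b j + c + (b j - a j) - c = d - a j" using ab h by simp
      moreover have "d - b j + c - (c - 1) = d - b j + 1" using h by simp
      ultimately show ?thesis by simp
    qed
    also have "\<dots> \<le> int (b j - a j) * U" using U by (rule mult_left_mono) simp
    finally have 1: "quadrant_min L (d - b j + 1) \<le> (int (b j) - int (a j)) * U"
      using ab by (simp add: of_nat_diff)
    have "(int c - int (b j)) * quadrant_min L (d - b j) \<le> (int c - int (b j)) * (U + V - W)"
      using V W h by (intro mult_left_mono) auto
    moreover have "union_min (c # L) d \<le> quadrant_min L (d - b j + 1) + (int c - int (b j)) * quadrant_min L (d - b j)"
      using union_min_le_quadrant_min[OF cL, of "c - b j" d] h ab \<open>1 \<le> d\<close> by (simp add: of_nat_diff)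
    ultimately have "union_min (c # L) d \<le> (int (b j) - int (a j)) * U + (int c - int (b j)) * (U + V - W)"
      using 1 by linarith
    then show ?thesis unfolding U_def[symmetric] V_def[symmetric] W_def[symmetric]
      by (simp add: algebra_simps)
  qed
  consider "a j < b j" | "b j < a j" | "a j = b j" by linarith
  then show ?case
  proof cases
    case 1
    have "union_min (c # L) d \<le> (int c - int (a j)) * (\<Prod>j\<leftarrow>js. int (e j) - int (a j))
      + (int c - int (b j)) * (\<Prod>j\<leftarrow>js. int (e j) - int (b j))
      - (int c - int (b j)) * (\<Prod>j\<leftarrow>js. int (e j) - int (max (a j) (b j)))"
      using 1 Cons.prems by (intro main) (auto simp: c_def)
    moreover have "max (a j) (b j) = b j" using 1 by simp
    ultimately show ?thesis by (simp add: c_def L_def)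
  next
    case 2
    have "union_min (c # L) d \<le> (int c - int (b j)) * (\<Prod>j\<leftarrow>js. int (e j) - int (b j))
      + (int c - int (a j)) * (\<Prod>j\<leftarrow>js. int (e j) - int (a j))
      - (int c - int (a j)) * (\<Prod>j\<leftarrow>js. int (e j) - int (max (b j) (a j)))"
      using 2 Cons.prems by (intro main) (auto simp: c_def)
    moreover have "max (a j) (b j) = a j" using 2 by simp
    ultimately show ?thesis unfolding max.commute[of "b _"] by (simp add: c_def L_def)
  next
    case 3
    then have ne: "\<exists>i\<in>set js. a i \<noteq> b i" using Cons.prems by auto
    have d: "1 \<le> d - a j"
    proof (rule ccontr)
      assume "\<not> ?thesis"
      moreover have "a j + sum_list (map a js) \<le> d" "b j + sum_list (map b js) \<le> d" using Cons.prems by auto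
      ultimately have "sum_list (map a js) = 0" "sum_list (map b js) = 0" using 3 by linarith+
      then show False using ne by (auto simp: sum_list_eq_0_iff)
    qed
    have "union_min (c # L) d \<le> int (c - a j) * union_min L (d + (c - a j) - c)"
      using cL Cons.prems d by (intro union_min_step) (auto simp: c_def)
    also have "d + (c - a j) - c = d - a j" using Cons.prems by (auto simp: c_def)
    also have "int (c - a j) * union_min L (d - a j) \<le> int (c - a j) *
      ((\<Prod>j\<leftarrow>js. int (e j) - int (a j)) + (\<Prod>j\<leftarrow>js. int (e j) - int (b j))
      - (\<Prod>j\<leftarrow>js. int (e j) - int (max (a j) (b j))))"
      unfolding L_def using Cons.prems ne d 3 by (intro mult_left_mono Cons.IH) auto
    finally show ?thesis using 3 Cons.prems by (simp add: c_def L_def of_nat_diff algebra_simps)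
  qed
qed

lemma union_min_attained:
  assumes "\<forall>j\<in>set js. 2 \<le> e j" and "distinct js" and "js \<noteq> []" and "1 \<le> d"
  shows "\<exists>a b. (\<forall>j\<in>set js. a j < e j \<and> b j < e j) \<and> sum_list (map a js) \<le> d \<and> sum_list (map b js) \<le> d
    \<and> (\<exists>j\<in>set js. a j \<noteq> b j)
    \<and> (\<Prod>j\<leftarrow>js. int (e j) - int (a j)) + (\<Prod>j\<leftarrow>js. int (e j) - int (b j))
      - (\<Prod>j\<leftarrow>js. int (e j) - int (max (a j) (b j))) = union_min (map e js) d"
  using assms
proof (induction js arbitrary: d)
  case Nil
  then show ?case by simp
next
  case (Cons j js)
  show ?case
  proof (cases "d < e j \<or> js = []")
    case True
    show ?thesis
    proof (cases js)
      case Nil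
      \<comment> \<open>With one side left, the pair consists of the two highest exponents that \<open>d\<close> allows.\<close>
      define a where "a = min d (e j - 1)"
      show ?thesis using Nil Cons.prems
        by (intro exI[of _ "\<lambda>_. a"] exI[of _ "\<lambda>_. a - 1"])
           (auto simp: a_def min_def max_def of_nat_diff)
    next
      case (Cons i ks)
      have i: "i \<noteq> j" "i \<notin> set ks" "j \<notin> set ks" "d < e j" using Cons Cons.prems True by auto
      have Q: "(\<Prod>i\<leftarrow>ks. int (e i)) = int (prod_list (map e ks))" by (induction ks) auto
      define a b :: "'a \<Rightarrow> nat" where "a = (\<lambda>x. if x = j then d else 0)"
        and "b = (\<lambda>x. if x = j then d - 1 else if x = i then 1 else 0)"
      have ab: "\<forall>x\<in>set ks. a x = 0 \<and> b x = 0" using i by (auto simp: a_def b_def)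
      have s: "sum_list (map a ks) = 0" "sum_list (map b ks) = 0" using ab by auto
      have m: "map (\<lambda>x. int (e x) - int (a x)) ks = map (\<lambda>x. int (e x)) ks"
        "map (\<lambda>x. int (e x) - int (b x)) ks = map (\<lambda>x. int (e x)) ks"
        "map (\<lambda>x. int (e x) - int (max (a x) (b x))) ks = map (\<lambda>x. int (e x)) ks"
        using ab by auto
      have v: "a j = d" "a i = 0" "b j = d - 1" "b i = 1" using i by (auto simp: a_def b_def)
      have "e i \<ge> 2" "e j \<ge> 2" "\<forall>x\<in>set ks. e x \<ge> 2" using Cons.prems Cons by auto
      then show ?thesis unfolding Cons using i ab \<open>1 \<le> d\<close>
        by (intro exI[of _ a] exI[of _ b])
           (auto simp only: list.map sum_list.Cons prod_list.Cons m s v Q,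
            auto simp: v max_def of_nat_diff algebra_simps)
    qed
  next
    case False
    then have d: "1 \<le> d - (e j - 1)" using Cons.prems by auto
    obtain a b where ab: "\<forall>i\<in>set js. a i < e i \<and> b i < e i" "sum_list (map a js) \<le> d - (e j - 1)"
      "sum_list (map b js) \<le> d - (e j - 1)" "\<exists>i\<in>set js. a i \<noteq> b i"
      "(\<Prod>j\<leftarrow>js. int (e j) - int (a j)) + (\<Prod>j\<leftarrow>js. int (e j) - int (b j))
      - (\<Prod>j\<leftarrow>js. int (e j) - int (max (a j) (b j))) = union_min (map e js) (d - (e j - 1))"
      using Cons.IH[OF _ _ _ d] Cons.prems False by auto
    define a' b' where "a' = a(j := e j - 1)" and "b' = b(j := e j - 1)"
    have eq: "\<forall>i\<in>set js. a' i = a i \<and> b' i = b i" using Cons.prems by (auto simp: a'_def b'_def)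
    then have m: "map a' js = map a js" "map b' js = map b js"
      "map (\<lambda>j. int (e j) - int (a' j)) js = map (\<lambda>j. int (e j) - int (a j)) js"
      "map (\<lambda>j. int (e j) - int (b' j)) js = map (\<lambda>j. int (e j) - int (b j)) js"
      "map (\<lambda>j. int (e j) - int (max (a' j) (b' j))) js = map (\<lambda>j. int (e j) - int (max (a j) (b j))) js"
      by auto
    have v: "a' j = e j - 1" "b' j = e j - 1" by (auto simp: a'_def b'_def)
    have "\<forall>i\<in>set (j # js). a' i < e i \<and> b' i < e i" using ab(1) eq v Cons.prems by auto
    moreover have "\<exists>i\<in>set (j # js). a' i \<noteq> b' i" using ab(4) eq by auto
    moreover have "int (e j) - int (e j - 1) = 1" using Cons.prems by (auto simp: of_nat_diff)
    ultimately show ?thesis using ab(2,3,5) False Cons.prems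
      by (intro exI[of _ a'] exI[of _ b'])
         (simp only: list.map sum_list.Cons prod_list.Cons m v, auto)
  qed
qed

lemma union_min_large:
  assumes "\<forall>c\<in>set L. 2 \<le> c" and "(\<Sum>c\<leftarrow>L. c - 1) \<le> d"
  shows "union_min L d = 2"
  using assms
proof (induction L arbitrary: d)
  case Nil
  then show ?case by simp
next
  case (Cons c L)
  have c: "2 \<le> c" and L: "\<forall>c\<in>set L. 2 \<le> c" using Cons.prems(1) by auto
  have sum: "(c - 1) + (\<Sum>c\<leftarrow>L. c - 1) \<le> d" using Cons.prems(2) by (simp only: list.map sum_list.Cons)
  show ?case
  proof (cases "d < c")
    case True
    then have 0: "(\<Sum>c\<leftarrow>L. c - 1) = 0" "d = c - 1" using sum c by linarith+
    have "L = []"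
    proof (cases L)
      case (Cons b L')
      then have "b - 1 = 0" using 0(1) by (simp only: list.map sum_list.Cons)
      then show ?thesis using L Cons by auto
    qed
    then show ?thesis using 0(2) c by (simp add: of_nat_diff)
  next
    case False
    have "union_min L (d - (c - 1)) = 2" using sum by (intro Cons.IH L) linarith
    then show ?thesis using False by simp
  qed
qed

lemma union_min_eq:
  assumes "1 \<le> j" "j \<le> k + 1" and "k + 2 \<le> s" and "\<forall>i\<in>{j..k}. 1 \<le> e i" and "1 \<le> l" and "l \<le> e (k + 1) - 1"
  shows "union_min (map e [j..<s]) ((\<Sum>i=j..k. (e i - 1)) + l) =
    (int (e (k+1)) - int l + 1) * int (prod_list (map e [k+2..<s])) - int (corner (map e [k+2..<s]))"
  using assms
proof (induction "k + 1 - j" arbitrary: j)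
  case 0
  then have j: "j = k + 1" by simp
  have "[j..<s] = j # [k+2..<s]" using 0 j by (simp add: upt_rec)
  then show ?case using 0 j by auto
next
  case (Suc x)
  have "[j..<s] = j # [Suc j..<s]" using Suc by (simp add: upt_rec)
  moreover have "(\<Sum>i=j..k. (e i - 1)) = (e j - 1) + (\<Sum>i=Suc j..k. (e i - 1))"
    using Suc by (simp add: sum.atLeast_Suc_atMost)
  moreover have "1 \<le> e j" using Suc by auto
  moreover have "union_min (map e [Suc j..<s]) ((\<Sum>i=Suc j..k. (e i - 1)) + l) =
    (int (e (k+1)) - int l + 1) * int (prod_list (map e [k+2..<s])) - int (corner (map e [k+2..<s]))"
    using Suc by (intro Suc(1)) auto
  ultimately show ?case using \<open>1 \<le> l\<close> by auto
qed

section \<open>Leading terms in spans of vectors\<close>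

lemma sum_apply: "(\<Sum>k\<in>K. f k) i = (\<Sum>k\<in>K. f k i)"
  by (induction K rule: infinite_finite_induct) auto

lemma span_mult:
  assumes "x \<in> coord.span S"
  shows "(\<lambda>i. h i * x i) \<in> coord.span ((\<lambda>y i. h i * y i) ` S)"
  using assms
proof (induction rule: coord.span_induct_alt)
  case base
  have "(\<lambda>i. h i * (0 :: nat \<Rightarrow> 'a) i) = 0" by auto
  then show ?case using coord.span_zero by metis
next
  case (step c x y)
  have "(\<lambda>i. h i * (vscale c x + y) i) = vscale c (\<lambda>i. h i * x i) + (\<lambda>i. h i * y i)"
    by (auto simp: vscale_def algebra_simps)
  moreover have "vscale c (\<lambda>i. h i * x i) \<in> coord.span ((\<lambda>y i. h i * y i) ` S)"
    using step by (intro coord.span_scale coord.span_base) auto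
  ultimately show ?case using step by (metis coord.span_add)
qed

text \<open>Well-founded rewriting: if every vector \<open>v b\<close> that is not yet in the span of \<open>G\<close> is a combination
  of vectors of smaller weight, then all of them are in the span of \<open>G\<close>.\<close>

lemma span_reduce:
  fixes w :: "'b \<Rightarrow> nat"
  assumes "\<And>b. Q b \<Longrightarrow> v b \<in> coord.span G \<or> v b \<in> coord.span (v ` {c. Q c \<and> w c < w b})" and "Q b"
  shows "v b \<in> coord.span G"
  using \<open>Q b\<close>
proof (induction "w b" arbitrary: b rule: less_induct)
  case less
  have "coord.span (v ` {c. Q c \<and> w c < w b}) \<subseteq> coord.span G"
    using less by (intro coord.span_minimal coord.subspace_span) auto
  then show ?case using assms(1)[OF less(2)] by auto
qed

text \<open>The leading index is the one of largest weight that the span still needs: \<open>t\<close> is least such that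
  the indices of weight below \<open>t\<close> suffice for \<open>f\<close>, so the index of weight \<open>t - 1\<close>, unique by
  injectivity, has a nonzero coefficient.\<close>

lemma leading_term:
  fixes w :: "'b \<Rightarrow> nat"
  assumes "finite B" and "inj_on w B" and "f \<in> coord.span (v ` B)" and "f \<noteq> 0"
  obtains a r where "a \<in> B" "r \<noteq> 0" "f - vscale r (v a) \<in> coord.span (v ` {c \<in> B. w c < w a})"
proof -
  define Q where "Q t \<longleftrightarrow> f \<in> coord.span (v ` {c \<in> B. w c < t})" for t
  have "{c \<in> B. w c < Suc (Max (w ` B))} = B" using \<open>finite B\<close> by (auto simp: less_Suc_eq_le)
  then have ex: "Q (Suc (Max (w ` B)))" using assms by (simp add: Q_def)
  define t where "t = (LEAST t. Q t)"
  have Qt: "Q t" unfolding t_def using ex by (rule LeastI)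
  have "\<not> Q 0" using \<open>f \<noteq> 0\<close> by (simp add: Q_def)
  with Qt obtain t' where t': "t = Suc t'" by (cases t) auto
  then have nQ: "\<not> Q t'" using not_less_Least[of t' Q] by (simp add: t_def)
  have "\<exists>a\<in>B. w a = t'"
  proof (rule ccontr)
    assume "\<not> ?thesis"
    then have "{c \<in> B. w c < Suc t'} = {c \<in> B. w c < t'}" by (auto simp: less_Suc_eq)
    then show False using Qt nQ t' by (simp add: Q_def)
  qed
  then obtain a where a: "a \<in> B" "w a = t'" by auto
  then have "{c \<in> B. w c < Suc t'} = insert a {c \<in> B. w c < t'}"
    using \<open>inj_on w B\<close> by (auto simp: less_Suc_eq inj_on_def)
  then have "f \<in> coord.span (insert (v a) (v ` {c \<in> B. w c < t'}))" using Qt t' by (simp add: Q_def)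
  then obtain r where r: "f - vscale r (v a) \<in> coord.span (v ` {c \<in> B. w c < t'})"
    by (auto simp: coord.span_breakdown_eq)
  moreover have "r \<noteq> 0"
  proof
    assume "r = 0"
    then have "f - vscale r (v a) = f" by (auto simp: vscale_def)
    then show False using r nQ unfolding Q_def by (simp only:)
  qed
  ultimately show thesis using that a by blast
qed

text \<open>If \<open>f\<close> and \<open>g\<close> have the same leading index, subtracting a multiple of \<open>f\<close> from \<open>g\<close> cancels
  it, and what remains is nonzero and has a smaller leading index.\<close>

lemma two_leading_terms:
  fixes w :: "'b \<Rightarrow> nat"
  assumes "finite B" and "inj_on w B" and fB: "f \<in> coord.span (v ` B)" and gB: "g \<in> coord.span (v ` B)"
    and "f \<noteq> 0" and ng: "\<And>k. g \<noteq> vscale k f"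
  obtains a b r r' f' g' where "a \<in> B" "b \<in> B" "a \<noteq> b" "f' \<in> coord.span {f, g}" "g' \<in> coord.span {f, g}"
    "r \<noteq> 0" "f' - vscale r (v a) \<in> coord.span (v ` {c \<in> B. w c < w a})"
    "r' \<noteq> 0" "g' - vscale r' (v b) \<in> coord.span (v ` {c \<in> B. w c < w b})"
proof -
  have fs: "f \<in> coord.span {f, g}" "g \<in> coord.span {f, g}" by (auto intro: coord.span_base)
  obtain a r where a: "a \<in> B" "r \<noteq> 0" "f - vscale r (v a) \<in> coord.span (v ` {c \<in> B. w c < w a})"
    using leading_term[OF assms(1-2) fB \<open>f \<noteq> 0\<close>] by blast
  have "g \<noteq> 0" using ng[of 0] by simp
  then obtain b r' where b: "b \<in> B" "r' \<noteq> 0" "g - vscale r' (v b) \<in> coord.span (v ` {c \<in> B. w c < w b})"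
    using leading_term[OF assms(1-2) gB] by blast
  show thesis
  proof (cases "a = b")
    case False
    then show thesis using that[OF a(1) b(1) False fs a(2,3) b(2,3)] by blast
  next
    case True
    define h where "h = g - vscale (r' / r) f"
    have "h = (g - vscale r' (v b)) - vscale (r' / r) (f - vscale r (v a))"
      using True \<open>r \<noteq> 0\<close> by (auto simp: h_def vscale_def algebra_simps)
    then have h: "h \<in> coord.span (v ` {c \<in> B. w c < w a})"
      using a b True by (simp add: coord.span_diff coord.span_scale)
    have "h \<noteq> 0" using ng by (auto simp: h_def)
    have "finite {c \<in> B. w c < w a}" "inj_on w {c \<in> B. w c < w a}"
      using assms(1,2) by (auto intro: inj_on_subset)
    then obtain b' s where b': "b' \<in> {c \<in> B. w c < w a}" "s \<noteq> 0"
      "h - vscale s (v b') \<in> coord.span (v ` {c \<in> {c \<in> B. w c < w a}. w c < w b'})"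
      using leading_term[OF _ _ h \<open>h \<noteq> 0\<close>] by blast
    have "coord.span (v ` {c \<in> {c \<in> B. w c < w a}. w c < w b'}) \<subseteq> coord.span (v ` {c \<in> B. w c < w b'})"
      by (intro coord.span_mono) auto
    moreover have "h \<in> coord.span {f, g}" unfolding h_def using fs by (intro coord.span_diff coord.span_scale)
    ultimately show thesis using that[of a b' f h r s] fs a b' by blast
  qed
qed

text \<open>A product of linear factors is monic. At the points of \<open>T\<close> it vanishes and so expresses the power
  \<open>x ^ card T\<close> by lower powers.\<close>

lemma prod_linear_expand:
  fixes T :: "'a::comm_ring_1 set"
  assumes "finite T"
  shows "\<exists>r. \<forall>x. (\<Prod>\<alpha>\<in>T. x - \<alpha>) = x ^ card T + (\<Sum>k<card T. r k * x ^ k)"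
  using assms
proof (induction T)
  case empty
  then show ?case by simp
next
  case (insert \<alpha> T)
  then obtain r where r: "\<And>x. (\<Prod>\<alpha>\<in>T. x - \<alpha>) = x ^ card T + (\<Sum>k<card T. r k * x ^ k)" by blast
  define r' where "r' = r(card T := 1)"
  have r': "(\<Prod>\<alpha>\<in>T. x - \<alpha>) = (\<Sum>k<Suc (card T). r' k * x ^ k)" for x
    unfolding r by (simp add: r'_def)
  \<comment> \<open>The coefficients of \<open>(x - \<alpha>)\<close> times the old product, below the leading one.\<close>
  define q where "q k = (case k of 0 \<Rightarrow> 0 | Suc k' \<Rightarrow> r k') - \<alpha> * r' k" for k
  have "(\<Prod>\<alpha>\<in>insert \<alpha> T. x - \<alpha>) = x ^ card (insert \<alpha> T) + (\<Sum>k<card (insert \<alpha> T). q k * x ^ k)" for x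
  proof -
    have "(\<Sum>k<Suc (card T). q k * x ^ k) =
      (\<Sum>k<Suc (card T). (case k of 0 \<Rightarrow> 0 | Suc k' \<Rightarrow> r k') * x ^ k) - \<alpha> * (\<Sum>k<Suc (card T). r' k * x ^ k)"
      by (simp only: q_def left_diff_distrib sum_subtractf sum_distrib_left mult.assoc)
    also have "(\<Sum>k<Suc (card T). (case k of 0 \<Rightarrow> 0 | Suc k' \<Rightarrow> r k') * x ^ k) = x * (\<Sum>k<card T. r k * x ^ k)"
      by (subst sum.lessThan_Suc_shift) (simp add: sum_distrib_left mult_ac)
    finally have "x ^ Suc (card T) + (\<Sum>k<Suc (card T). q k * x ^ k) =
       x * (\<Prod>\<alpha>\<in>T. x - \<alpha>) - \<alpha> * (\<Prod>\<alpha>\<in>T. x - \<alpha>)"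
      unfolding r'[symmetric] by (simp add: r algebra_simps)
    then show ?thesis using insert by (simp add: left_diff_distrib)
  qed
  then show ?case by blast
qed

text \<open>Uniqueness of the digits in base \<open>N\<close>. It makes the weight below injective on the box.\<close>

lemma digits_inj:
  fixes b c :: "nat \<Rightarrow> nat"
  assumes "\<forall>j\<in>{1..n}. b j < N \<and> c j < N" and "(\<Sum>j=1..n. b j * N ^ j) = (\<Sum>j=1..n. c j * N ^ j)"
  shows "\<forall>j\<in>{1..n}. b j = c j"
  using assms
proof (induction n)
  case 0
  then show ?case by simp
next
  case (Suc n)
  have lt: "(\<Sum>j=1..n. b j * N ^ j) < N ^ Suc n" if "\<forall>j\<in>{1..n}. b j < N" "0 < N" for b
    using that
  proof (induction n)
    case (Suc n)
    have "(\<Sum>j=1..Suc n. b j * N ^ j) < N ^ Suc n + b (Suc n) * N ^ Suc n" using Suc by auto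
    also have "\<dots> = Suc (b (Suc n)) * N ^ Suc n" by simp
    also have "\<dots> \<le> N * N ^ Suc n" using Suc by (intro mult_right_mono) (auto simp: Suc_le_eq)
    finally show ?case by simp
  qed simp
  have "b (Suc n) < N" using Suc.prems(1) by simp
  then have N: "0 < N" by simp
  define x y where "x = (\<Sum>j=1..n. b j * N ^ j)" and "y = (\<Sum>j=1..n. c j * N ^ j)"
  have xy: "x < N ^ Suc n" "y < N ^ Suc n" unfolding x_def y_def by (rule lt; use Suc.prems N in auto)+
  have eq: "x + b (Suc n) * N ^ Suc n = y + c (Suc n) * N ^ Suc n"
    using Suc.prems(2) by (simp add: x_def y_def)
  have "(x + b (Suc n) * N ^ Suc n) div N ^ Suc n = b (Suc n)"
    "(y + c (Suc n) * N ^ Suc n) div N ^ Suc n = c (Suc n)"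
    using xy N by (simp_all del: power_Suc)
  then have "b (Suc n) = c (Suc n)" using eq by simp
  moreover from this have "x = y" using eq by simp
  moreover from this have "\<forall>j\<in>{1..n}. b j = c j" using Suc.prems by (intro Suc.IH) (auto simp: x_def y_def)
  ultimately show ?case by (auto simp: le_Suc_eq)
qed

section \<open>The footprint bound on a grid\<close>

text \<open>The points are numbered by \<open>{1..m}\<close>; only their first \<open>n\<close> coordinates are restricted to the grid,
  so that the normalised last coordinate may be present.\<close>

locale cartesian_grid =
  fixes n m :: nat and A :: "nat \<Rightarrow> 'a::field set" and e :: "nat \<Rightarrow> nat" and P :: "nat \<Rightarrow> nat \<Rightarrow> 'a"
  assumes finite_A: "j \<in> {1..n} \<Longrightarrow> finite (A j)"
    and card_A: "j \<in> {1..n} \<Longrightarrow> e j = card (A j)"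
    and enum: "bij_betw (\<lambda>i. restrict (P i) {1..n}) {1..m} (PiE {1..n} A)"
begin

text \<open>The values of a monomial at the points in \<open>Z\<close>, extended by 0 to a vector in the
  sense of \<open>coord\<close>.\<close>

definition monom_vec :: "nat set \<Rightarrow> (nat \<Rightarrow> nat) \<Rightarrow> nat \<Rightarrow> 'a" where
  "monom_vec Z b = (\<lambda>i. if i \<in> Z then \<Prod>j=1..n. P i j ^ b j else 0)"

definition deg :: "(nat \<Rightarrow> nat) \<Rightarrow> nat" where
  "deg b = (\<Sum>j=1..n. b j)"

text \<open>A monomial order encoded by natural numbers: the base exceeds every side of the box, so that weights
  separate the exponents of the box, and additivity in \<open>b\<close> makes the order compatible with
  multiplication.\<close>

definition weight :: "(nat \<Rightarrow> nat) \<Rightarrow> nat" where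
  "weight b = (\<Sum>j=1..n. b j * Suc (\<Sum>j=1..n. e j) ^ j)"

definition box :: "(nat \<Rightarrow> nat) set" where
  "box = PiE {1..n} (\<lambda>j. {..<e j})"

definition quadrant :: "(nat \<Rightarrow> nat) \<Rightarrow> (nat \<Rightarrow> nat) set" where
  "quadrant a = PiE {1..n} (\<lambda>j. {a j..<e j})"

lemma P_in: "i \<in> {1..m} \<Longrightarrow> j \<in> {1..n} \<Longrightarrow> P i j \<in> A j"
  using bij_betwE[OF enum] by (auto simp: PiE_def Pi_def)

lemma finite_box: "finite box"
  by (auto simp: box_def intro: finite_PiE)

lemma quadrant_subset: "quadrant a \<subseteq> box"
  unfolding quadrant_def box_def by (auto simp: PiE_def Pi_def)

lemma weight_inj: "inj_on weight box"
proof (rule inj_onI)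
  fix b c assume bc: "b \<in> box" "c \<in> box" "weight b = weight c"
  have "b j < Suc (\<Sum>j=1..n. e j) \<and> c j < Suc (\<Sum>j=1..n. e j)" if "j \<in> {1..n}" for j
  proof -
    have "e j \<le> (\<Sum>j=1..n. e j)" using that by (intro member_le_sum) auto
    moreover have "b j < e j" "c j < e j" using bc that unfolding box_def by auto
    ultimately show ?thesis by auto
  qed
  then have "\<forall>j\<in>{1..n}. b j = c j" using bc(3) unfolding weight_def by (intro digits_inj) auto
  then show "b = c" using bc(1,2) unfolding box_def by (intro PiE_ext[of b _ _ c]) auto
qed

lemma monom_vec_add: "monom_vec Z (\<lambda>j. a j + u j) = (\<lambda>i. monom_vec Z u i * monom_vec Z a i)"
  by (auto simp: monom_vec_def power_add prod.distrib mult.commute)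

lemma monom_vec_cong: "(\<And>j. j \<in> {1..n} \<Longrightarrow> a j = b j) \<Longrightarrow> monom_vec Z a = monom_vec Z b"
  by (auto simp: monom_vec_def)

lemma weight_add: "weight (\<lambda>j. a j + u j) = weight a + weight u"
  by (simp only: weight_def distrib_right sum.distrib)

lemma weight_cong: "(\<And>j. j \<in> {1..n} \<Longrightarrow> a j = b j) \<Longrightarrow> weight a = weight b"
  by (simp add: weight_def)

lemma deg_cong: "(\<And>j. j \<in> {1..n} \<Longrightarrow> a j = b j) \<Longrightarrow> deg a = deg b"
  by (simp add: deg_def)

lemma deg_upd:
  assumes "j \<in> {1..n}"
  shows "deg (b(j := k)) + b j = deg b + k"
proof -
  have split: "deg c = c j + (\<Sum>i\<in>{1..n} - {j}. c i)" for c
    unfolding deg_def using assms by (intro sum.remove) auto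
  have "(\<Sum>i\<in>{1..n} - {j}. (b(j := k)) i) = (\<Sum>i\<in>{1..n} - {j}. b i)"
    by (intro sum.cong) auto
  then show ?thesis unfolding split[of b] split[of "b(j := k)"] by simp
qed

lemma weight_upd:
  assumes "j \<in> {1..n}" and "k < b j"
  shows "weight (b(j := k)) < weight b"
  unfolding weight_def using assms by (intro sum_strict_mono_ex1) auto

lemma monom_vec_upd:
  assumes "j \<in> {1..n}"
  shows "monom_vec Z (b(j := k)) = (\<lambda>i. P i j ^ k * monom_vec Z (b(j := 0)) i)"
proof
  fix i
  have split: "(\<Prod>j=1..n. P i j ^ c j) = P i j ^ c j * (\<Prod>l\<in>{1..n} - {j}. P i l ^ c l)" for c
    using assms by (intro prod.remove) auto
  have "(\<Prod>l\<in>{1..n} - {j}. P i l ^ (b(j := k)) l) = (\<Prod>l\<in>{1..n} - {j}. P i l ^ (b(j := 0)) l)"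
    by (intro prod.cong) auto
  then show "monom_vec Z (b(j := k)) i = P i j ^ k * monom_vec Z (b(j := 0)) i"
    unfolding monom_vec_def split[of "b(j := k)"] split[of "b(j := 0)"] by simp
qed

text \<open>Multiplying the relation for \<open>a\<close> by the monomial of exponent \<open>b - a\<close> shifts all weights equally.\<close>

lemma reducible_multiple:
  assumes "monom_vec Z a \<in> coord.span (monom_vec Z ` {c. weight c < weight a})" and "\<forall>j\<in>{1..n}. a j \<le> b j"
  shows "monom_vec Z b \<in> coord.span (monom_vec Z ` {c. weight c < weight b})"
proof -
  define u where "u j = b j - a j" for j
  have b: "a j + u j = b j" if "j \<in> {1..n}" for j using assms that by (simp add: u_def)
  have sub: "(\<lambda>y i. monom_vec Z u i * y i) ` monom_vec Z ` {c. weight c < weight a} \<subseteq> monom_vec Z ` {c. weight c < weight b}"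
  proof clarify
    fix c assume "weight c < weight a"
    then have "weight (\<lambda>j. c j + u j) < weight b"
      unfolding weight_add using weight_cong[of "\<lambda>j. a j + u j" b, OF b] by (simp add: weight_add)
    then show "(\<lambda>i. monom_vec Z u i * monom_vec Z c i) \<in> monom_vec Z ` {c. weight c < weight b}"
      unfolding monom_vec_add[symmetric] by blast
  qed
  have "monom_vec Z b = monom_vec Z (\<lambda>j. a j + u j)" by (rule monom_vec_cong) (simp add: b)
  then have "monom_vec Z b = (\<lambda>i. monom_vec Z u i * monom_vec Z a i)" by (simp only: monom_vec_add)
  moreover have "(\<lambda>i. monom_vec Z u i * monom_vec Z a i)
      \<in> coord.span ((\<lambda>y i. monom_vec Z u i * y i) ` monom_vec Z ` {c. weight c < weight a})"
    using assms(1) by (rule span_mult)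
  ultimately show ?thesis using coord.span_mono[OF sub] by (simp only:) (rule subsetD)
qed

text \<open>Outside the box some variable has exponent at least \<open>e j\<close>, and \<open>prod_linear_expand\<close> for \<open>A j\<close>
  replaces that power by lower ones.\<close>

lemma reducible_outside_box:
  assumes "Z \<subseteq> {1..m}" and j: "j \<in> {1..n}" and "e j \<le> b j"
  shows "monom_vec Z b \<in> coord.span (monom_vec Z ` {c. deg c \<le> deg b \<and> weight c < weight b})"
proof -
  obtain r where r: "\<And>x. (\<Prod>\<alpha>\<in>A j. x - \<alpha>) = x ^ e j + (\<Sum>k<e j. r k * x ^ k)"
    using prod_linear_expand[OF finite_A[OF j]] card_A[OF j] by auto
  have z: "P i j ^ b j = - (\<Sum>k<e j. r k * P i j ^ (b j - e j + k))" if "i \<in> Z" for i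
  proof -
    have "(\<Prod>\<alpha>\<in>A j. P i j - \<alpha>) = 0" using that assms P_in finite_A[OF j] by (auto intro!: prod_zero)
    then have "P i j ^ e j = - (\<Sum>k<e j. r k * P i j ^ k)" unfolding r by (simp add: eq_neg_iff_add_eq_0)
    then have "P i j ^ (b j - e j) * P i j ^ e j = - (\<Sum>k<e j. r k * P i j ^ (b j - e j + k))"
      by (simp add: sum_distrib_left power_add mult_ac)
    then show ?thesis using \<open>e j \<le> b j\<close> by (simp add: power_add[symmetric])
  qed
  have "monom_vec Z b = - (\<Sum>k<e j. vscale (r k) (monom_vec Z (b(j := b j - e j + k))))"
  proof
    fix i
    have "monom_vec Z b i = monom_vec Z (b(j := b j)) i" by simp
    also have "\<dots> = P i j ^ b j * monom_vec Z (b(j := 0)) i" using monom_vec_upd[OF j] by metis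
    also have "\<dots> = - (\<Sum>k<e j. r k * (P i j ^ (b j - e j + k) * monom_vec Z (b(j := 0)) i))"
    proof (cases "i \<in> Z")
      case True
      then show ?thesis by (simp add: z sum_distrib_right mult.assoc)
    qed (simp add: monom_vec_def)
    also have "\<dots> = (- (\<Sum>k<e j. vscale (r k) (monom_vec Z (b(j := b j - e j + k))))) i"
      by (subst monom_vec_upd[OF j]) (simp add: vscale_def sum_apply)
    finally show "monom_vec Z b i = (- (\<Sum>k<e j. vscale (r k) (monom_vec Z (b(j := b j - e j + k))))) i" .
  qed
  moreover have "b(j := b j - e j + k) \<in> {c. deg c \<le> deg b \<and> weight c < weight b}" if "k < e j" for k
    using deg_upd[OF j, of b "b j - e j + k"] weight_upd[OF j, of "b j - e j + k" b] that \<open>e j \<le> b j\<close> by auto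
  ultimately show ?thesis
    by (simp only:) (intro coord.span_neg coord.span_sum coord.span_scale coord.span_base, auto)
qed

lemma monom_vec_restrict: "monom_vec Z (restrict b {1..n}) = monom_vec Z b"
  by (intro monom_vec_cong) auto

lemma restrict_in_box: "\<forall>j\<in>{1..n}. b j < e j \<Longrightarrow> restrict b {1..n} \<in> box"
  by (auto simp: box_def)

text \<open>Rewriting an exponent outside the box lowers its weight and does not raise its degree.\<close>

lemma span_box_eq:
  assumes "Z \<subseteq> {1..m}"
  shows "coord.span (monom_vec Z ` {b. deg b \<le> d}) = coord.span (monom_vec Z ` {b \<in> box. deg b \<le> d})"
proof
  have "monom_vec Z b \<in> coord.span (monom_vec Z ` {b \<in> box. deg b \<le> d})" if "deg b \<le> d" for b
    using that
  proof (rule span_reduce[where w = weight and Q = "\<lambda>b. deg b \<le> d", rotated])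
    fix b assume b: "deg b \<le> d"
    show "monom_vec Z b \<in> coord.span (monom_vec Z ` {b \<in> box. deg b \<le> d}) \<or>
      monom_vec Z b \<in> coord.span (monom_vec Z ` {c. deg c \<le> d \<and> weight c < weight b})"
    proof (cases "\<forall>j\<in>{1..n}. b j < e j")
      case True
      have "deg (restrict b {1..n}) = deg b" by (intro deg_cong) auto
      then have "monom_vec Z b \<in> monom_vec Z ` {b \<in> box. deg b \<le> d}"
        using restrict_in_box[OF True] b
        by (intro image_eqI[of _ _ "restrict b {1..n}"] monom_vec_restrict[symmetric]) simp
      then show ?thesis by (auto intro: coord.span_base)
    next
      case False
      then obtain j where "j \<in> {1..n}" "e j \<le> b j" by auto
      then have "monom_vec Z b \<in> coord.span (monom_vec Z ` {c. deg c \<le> deg b \<and> weight c < weight b})"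
        using assms by (intro reducible_outside_box)
      moreover have "coord.span (monom_vec Z ` {c. deg c \<le> deg b \<and> weight c < weight b})
        \<subseteq> coord.span (monom_vec Z ` {c. deg c \<le> d \<and> weight c < weight b})"
        using b by (intro coord.span_mono) auto
      ultimately show ?thesis by blast
    qed
  qed
  then show "coord.span (monom_vec Z ` {b. deg b \<le> d}) \<subseteq> coord.span (monom_vec Z ` {b \<in> box. deg b \<le> d})"
    by (intro coord.span_minimal coord.subspace_span) auto
qed (intro coord.span_mono, auto)

lemma span_linear_factor:
  assumes "x \<in> coord.span (monom_vec Z ` {b. deg b \<le> d})" and j: "j \<in> {1..n}"
  shows "(\<lambda>i. (P i j - \<alpha>) * x i) \<in> coord.span (monom_vec Z ` {b. deg b \<le> Suc d})"
proof -
  have "(\<lambda>y i. P i j * y i) ` monom_vec Z ` {b. deg b \<le> d} \<subseteq> monom_vec Z ` {b. deg b \<le> Suc d}"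
  proof clarify
    fix b assume b: "deg b \<le> d"
    have "monom_vec Z (b(j := Suc (b j))) = (\<lambda>i. P i j * monom_vec Z (b(j := b j)) i)"
      unfolding monom_vec_upd[OF j, of Z b "Suc (b j)"] monom_vec_upd[OF j, of Z b "b j"] by (simp add: mult.assoc)
    moreover have "deg (b(j := Suc (b j))) \<le> Suc d" using deg_upd[OF j, of b "Suc (b j)"] b by simp
    ultimately show "(\<lambda>i. P i j * monom_vec Z b i) \<in> monom_vec Z ` {b. deg b \<le> Suc d}"
      by (intro image_eqI[of _ _ "b(j := Suc (b j))"]) auto
  qed
  then have "(\<lambda>i. P i j * x i) \<in> coord.span (monom_vec Z ` {b. deg b \<le> Suc d})"
    using span_mult[OF assms(1), of "\<lambda>i. P i j"] coord.span_mono by blast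
  moreover have "x \<in> coord.span (monom_vec Z ` {b. deg b \<le> Suc d})"
    using assms(1) coord.span_mono[of "monom_vec Z ` {b. deg b \<le> d}" "monom_vec Z ` {b. deg b \<le> Suc d}"] by fastforce
  moreover have "(\<lambda>i. (P i j - \<alpha>) * x i) = (\<lambda>i. P i j * x i) - vscale \<alpha> x"
    by (auto simp: vscale_def algebra_simps)
  ultimately show ?thesis by (simp add: coord.span_diff coord.span_scale)
qed

lemma span_univariate_product:
  assumes "finite F" and "x \<in> coord.span (monom_vec Z ` {b. deg b \<le> d})" and "j \<in> {1..n}"
  shows "(\<lambda>i. (\<Prod>\<alpha>\<in>F. P i j - \<alpha>) * x i) \<in> coord.span (monom_vec Z ` {b. deg b \<le> card F + d})"
  using assms(1)
proof (induction F)
  case empty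
  then show ?case using assms(2) by simp
next
  case (insert \<alpha> F)
  have "(\<lambda>i. (P i j - \<alpha>) * ((\<Prod>\<alpha>\<in>F. P i j - \<alpha>) * x i))
      \<in> coord.span (monom_vec Z ` {b. deg b \<le> Suc (card F + d)})"
    using insert.IH assms(3) by (rule span_linear_factor)
  then show ?case using insert.hyps by (simp add: mult.assoc)
qed

lemma span_linear_product:
  assumes "J \<subseteq> {1..n}" and "\<And>j. j \<in> J \<Longrightarrow> finite (T j)"
  shows "(\<lambda>i. if i \<in> Z then \<Prod>j\<in>J. \<Prod>\<alpha>\<in>T j. P i j - \<alpha> else 0)
    \<in> coord.span (monom_vec Z ` {b. deg b \<le> (\<Sum>j\<in>J. card (T j))})"
proof -
  have "finite J" using assms(1) by (rule finite_subset) simp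
  then show ?thesis using assms
  proof (induction J)
    case empty
    have "(\<lambda>i. if i \<in> Z then \<Prod>j\<in>{}. \<Prod>\<alpha>\<in>T j. P i j - \<alpha> else 0) = monom_vec Z (\<lambda>_. 0)"
      by (rule ext) (simp add: monom_vec_def)
    moreover have "deg (\<lambda>_. 0) = 0" by (simp add: deg_def)
    ultimately show ?case by (simp only: sum.empty) (intro coord.span_base imageI, simp)
  next
    case (insert j J)
    define x where "x = (\<lambda>i. if i \<in> Z then \<Prod>j\<in>J. \<Prod>\<alpha>\<in>T j. P i j - \<alpha> else 0)"
    have "x \<in> coord.span (monom_vec Z ` {b. deg b \<le> (\<Sum>j\<in>J. card (T j))})"
      unfolding x_def using insert.prems by (intro insert.IH) auto
    then have "(\<lambda>i. (\<Prod>\<alpha>\<in>T j. P i j - \<alpha>) * x i)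
        \<in> coord.span (monom_vec Z ` {b. deg b \<le> card (T j) + (\<Sum>j\<in>J. card (T j))})"
      using insert.prems by (intro span_univariate_product) auto
    moreover have "(\<lambda>i. (\<Prod>\<alpha>\<in>T j. P i j - \<alpha>) * x i) =
        (\<lambda>i. if i \<in> Z then \<Prod>j\<in>insert j J. \<Prod>\<alpha>\<in>T j. P i j - \<alpha> else 0)"
      using insert.hyps by (intro ext) (simp add: x_def)
    moreover have "(\<Sum>j\<in>insert j J. card (T j)) = card (T j) + (\<Sum>j\<in>J. card (T j))"
      using insert.hyps by simp
    ultimately show ?case by (simp only:)
  qed
qed

text \<open>Interpolation: the product of the factors \<open>x j - \<alpha>\<close> over all \<open>\<alpha>\<close> in \<open>A j\<close> other than the
  coordinate of the point \<open>i0\<close> vanishes at every other point.\<close>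

lemma unit_vector_in_span:
  assumes "Z \<subseteq> {1..m}" and i0: "i0 \<in> Z"
  shows "(\<lambda>i. if i = i0 then 1 else 0) \<in> coord.span (range (monom_vec Z))"
proof -
  define T where "T j = A j - {P i0 j}" for j
  define x where "x = (\<lambda>i. if i \<in> Z then \<Prod>j\<in>{1..n}. \<Prod>\<alpha>\<in>T j. P i j - \<alpha> else 0)"
  have "x \<in> coord.span (monom_vec Z ` {b. deg b \<le> (\<Sum>j\<in>{1..n}. card (T j))})"
    unfolding x_def using finite_A by (intro span_linear_product) (auto simp: T_def)
  then have x: "x \<in> coord.span (range (monom_vec Z))"
    using coord.span_mono[of "monom_vec Z ` {b. deg b \<le> (\<Sum>j\<in>{1..n}. card (T j))}" "range (monom_vec Z)"] by blast
  have "finite (T j)" "P i0 j \<notin> T j" if "j \<in> {1..n}" for j using finite_A[OF that] by (auto simp: T_def)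
  then have "x i0 \<noteq> 0" using i0 by (auto simp: x_def)
  moreover have "x i = 0" if "i \<noteq> i0" for i
  proof (cases "i \<in> Z")
    case True
    then have "restrict (P i) {1..n} \<noteq> restrict (P i0) {1..n}"
      using inj_onD[OF bij_betw_imp_inj_on[OF enum], of i i0] that assms by blast
    then have "\<not> (\<forall>j\<in>{1..n}. P i j = P i0 j)" by (metis restrict_ext)
    then obtain j where j: "j \<in> {1..n}" "P i j \<noteq> P i0 j" by blast
    then have "P i j \<in> T j" using True assms(1) P_in[of i j] by (auto simp: T_def)
    then have "(\<Prod>\<alpha>\<in>T j. P i j - \<alpha>) = 0" using finite_A[OF j(1)] by (intro prod_zero) (auto simp: T_def)
    then have "(\<Prod>j\<in>{1..n}. \<Prod>\<alpha>\<in>T j. P i j - \<alpha>) = 0" using j(1) by (intro prod_zero) auto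
    then show ?thesis unfolding x_def by simp
  qed (simp add: x_def)
  ultimately have "(\<lambda>i. if i = i0 then 1 else 0) = vscale (inverse (x i0)) x"
    by (intro ext) (simp add: vscale_def)
  then show ?thesis using coord.span_scale[OF x, of "inverse (x i0)"] by (simp only:)
qed

lemma independent_unit_vectors:
  "coord.independent ((\<lambda>i0 i. if i = i0 then 1 else 0 :: 'a) ` Z)" (is "coord.independent (?u ` Z)")
proof
  assume "coord.dependent (?u ` Z)"
  then obtain i0 where i0: "i0 \<in> Z" "?u i0 \<in> coord.span (?u ` Z - {?u i0})"
    by (auto simp: coord.dependent_def)
  have "coord.subspace {x :: nat \<Rightarrow> 'a. x i0 = 0}" by (auto simp: coord.subspace_def vscale_def)
  moreover have "?u ` Z - {?u i0} \<subseteq> {x. x i0 = 0}"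
  proof
    fix x assume "x \<in> ?u ` Z - {?u i0}"
    then obtain i1 where "x = ?u i1" "i1 \<noteq> i0" by blast
    then show "x \<in> {x. x i0 = 0}" by simp
  qed
  ultimately have "?u i0 \<in> {x. x i0 = 0}" using coord.span_minimal i0(2) by blast
  then show False by simp
qed

text \<open>Rewriting by the relations for \<open>R\<close> and by those outside the box ends in monomials of the box that
  avoid every quadrant of \<open>R\<close>. Their span contains the unit vectors at the points of \<open>Z\<close>, which
  are independent and hence no more numerous than these monomials.\<close>

lemma footprint_bound:
  assumes Z: "Z \<subseteq> {1..m}"
    and R: "\<And>a. a \<in> R \<Longrightarrow> monom_vec Z a \<in> coord.span (monom_vec Z ` {c. weight c < weight a})"
  shows "card Z \<le> card (box - (\<Union>a\<in>R. quadrant a))"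
proof -
  define \<Delta> where "\<Delta> = box - (\<Union>a\<in>R. quadrant a)"
  have fin: "finite \<Delta>" by (simp add: \<Delta>_def finite_box)
  have step: "monom_vec Z b \<in> coord.span (monom_vec Z ` \<Delta>)
      \<or> monom_vec Z b \<in> coord.span (monom_vec Z ` {c. weight c < weight b})" for b
    proof (cases "\<forall>j\<in>{1..n}. b j < e j")
      case box: True
      show ?thesis
      proof (cases "restrict b {1..n} \<in> \<Delta>")
        case True
        then have "monom_vec Z (restrict b {1..n}) \<in> coord.span (monom_vec Z ` \<Delta>)"
          by (intro coord.span_base imageI)
        then show ?thesis unfolding monom_vec_restrict by blast
      next
        case False
        then obtain a where a: "a \<in> R" "restrict b {1..n} \<in> quadrant a"
          using restrict_in_box[OF box] by (auto simp: \<Delta>_def)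
        have "a j \<le> b j" if "j \<in> {1..n}" for j
          using PiE_mem[OF a(2)[unfolded quadrant_def] that] that by simp
        then show ?thesis using reducible_multiple[OF R[OF a(1)], of b] by blast
      qed
    next
      case False
      then obtain j where "j \<in> {1..n}" "e j \<le> b j" by auto
      then have "monom_vec Z b \<in> coord.span (monom_vec Z ` {c. deg c \<le> deg b \<and> weight c < weight b})"
        using Z by (intro reducible_outside_box)
      moreover have "coord.span (monom_vec Z ` {c. deg c \<le> deg b \<and> weight c < weight b})
        \<subseteq> coord.span (monom_vec Z ` {c. weight c < weight b})"
        by (intro coord.span_mono) auto
      ultimately show ?thesis by blast
    qed
  have "monom_vec Z b \<in> coord.span (monom_vec Z ` \<Delta>)" for b
    using span_reduce[of "\<lambda>_. True" "monom_vec Z" "monom_vec Z ` \<Delta>" weight b] step by simp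
  then have "coord.span (range (monom_vec Z)) \<subseteq> coord.span (monom_vec Z ` \<Delta>)"
    by (intro coord.span_minimal coord.subspace_span) auto
  then have "(\<lambda>i0 i. if i = i0 then 1 else 0 :: 'a) ` Z \<subseteq> coord.span (monom_vec Z ` \<Delta>)"
    using unit_vector_in_span[OF Z] by auto
  then have "card ((\<lambda>i0 i. if i = i0 then 1 else 0 :: 'a) ` Z) \<le> card (monom_vec Z ` \<Delta>)"
    using coord.independent_span_bound[OF _ independent_unit_vectors, of "monom_vec Z ` \<Delta>"] fin by auto
  also have "\<dots> \<le> card \<Delta>" using fin by (rule card_image_le)
  also have "card ((\<lambda>i0 i. if i = i0 then 1 else 0 :: 'a) ` Z) = card Z"
  proof (intro card_image inj_onI)
    fix i j assume "(\<lambda>k. if k = i then 1 else 0 :: 'a) = (\<lambda>k. if k = j then 1 else 0)"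
    from fun_cong[OF this, of i] show "i = j" by (simp split: if_splits)
  qed
  finally show ?thesis by (simp add: \<Delta>_def)
qed

text \<open>Where \<open>f\<close> vanishes, its leading monomial is a combination of the smaller ones.\<close>

lemma leading_term_reducible:
  assumes Z: "Z \<subseteq> {1..m}" and f: "\<And>i. i \<in> Z \<Longrightarrow> f i = 0" and "r \<noteq> 0"
    and lead: "f - vscale r (monom_vec {1..m} a) \<in> coord.span (monom_vec {1..m} ` {c \<in> B. weight c < weight a})"
  shows "monom_vec Z a \<in> coord.span (monom_vec Z ` {c. weight c < weight a})"
proof -
  \<comment> \<open>Multiplication by the indicator of \<open>Z\<close> is the restriction to \<open>Z\<close>.\<close>
  define h where "h = (\<lambda>i. if i \<in> Z then 1 else 0 :: 'a)"
  have hm: "(\<lambda>i. h i * monom_vec {1..m} b i) = monom_vec Z b" for b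
    by (rule ext) (use Z in \<open>auto simp: h_def monom_vec_def\<close>)
  have "(\<lambda>i. h i * (f - vscale r (monom_vec {1..m} a)) i) = vscale (- r) (monom_vec Z a)"
    unfolding hm[of a, symmetric] by (rule ext) (use f in \<open>simp add: h_def vscale_def\<close>)
  then have "vscale (- r) (monom_vec Z a) \<in> coord.span ((\<lambda>y i. h i * y i) ` monom_vec {1..m} ` {c \<in> B. weight c < weight a})"
    using span_mult[OF lead, of h] by simp
  also have "(\<lambda>y i. h i * y i) ` monom_vec {1..m} ` {c \<in> B. weight c < weight a} = monom_vec Z ` {c \<in> B. weight c < weight a}"
    by (simp only: image_image hm)
  finally have "vscale (- r) (monom_vec Z a) \<in> coord.span (monom_vec Z ` {c. weight c < weight a})"
    using coord.span_mono[of "monom_vec Z ` {c \<in> B. weight c < weight a}" "monom_vec Z ` {c. weight c < weight a}"] by blast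
  then have "vscale (inverse (- r)) (vscale (- r) (monom_vec Z a)) \<in> coord.span (monom_vec Z ` {c. weight c < weight a})"
    by (rule coord.span_scale)
  then show ?thesis using \<open>r \<noteq> 0\<close> by simp
qed

lemma card_box: "card box = m"
proof -
  have "m = card (PiE {1..n} A)" using bij_betw_same_card[OF enum] by simp
  then show ?thesis by (simp add: box_def card_PiE card_A)
qed

lemma support_ge_quadrants:
  assumes "coord.subspace D" and "coord.dim D = 2" and D: "D \<subseteq> coord.span (monom_vec {1..m} ` {b. deg b \<le> d})"
  obtains a b where "a \<in> box" "b \<in> box" "a \<noteq> b" "deg a \<le> d" "deg b \<le> d"
    "card (quadrant a \<union> quadrant b) \<le> card (code_support m D)"
proof -
  define B where "B = {b \<in> box. deg b \<le> d}"
  have B: "finite B" "inj_on weight B" using finite_box weight_inj by (auto simp: B_def intro: inj_on_subset)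
  obtain S where S: "S \<subseteq> D" "coord.independent S" "card S = 2"
    using coord.basis_exists[of D] \<open>coord.dim D = 2\<close> by metis
  then obtain f g where fg: "S = {f, g}" "f \<noteq> g" by (auto simp: card_2_iff)
  have f0: "f \<noteq> 0" using S coord.dependent_zero fg by blast
  have gf: "g \<noteq> vscale k f" for k
  proof
    assume "g = vscale k f"
    then have "g \<in> coord.span {f}" by (auto intro: coord.span_scale coord.span_base)
    moreover have "S - {g} = {f}" using fg by auto
    ultimately have "g \<in> coord.span (S - {g})" by (simp only:)
    then show False using S fg by (auto simp: coord.dependent_def)
  qed
  have fgB: "f \<in> coord.span (monom_vec {1..m} ` B)" "g \<in> coord.span (monom_vec {1..m} ` B)"
    using D S(1) fg(1) span_box_eq[OF subset_refl, of d] unfolding B_def by blast+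
  obtain a b r r' f' g' where ab: "a \<in> B" "b \<in> B" "a \<noteq> b"
    "f' \<in> coord.span {f, g}" "g' \<in> coord.span {f, g}"
    "r \<noteq> 0" "f' - vscale r (monom_vec {1..m} a) \<in> coord.span (monom_vec {1..m} ` {c \<in> B. weight c < weight a})"
    "r' \<noteq> 0" "g' - vscale r' (monom_vec {1..m} b) \<in> coord.span (monom_vec {1..m} ` {c \<in> B. weight c < weight b})"
    by (rule two_leading_terms[OF B fgB f0 gf])
  have "coord.span {f, g} \<subseteq> D" using S fg \<open>coord.subspace D\<close> by (intro coord.span_minimal) auto
  then have D': "f' \<in> D" "g' \<in> D" using ab by auto
  define Z where "Z = {1..m} - code_support m D"
  have Z: "Z \<subseteq> {1..m}" "\<And>x i. x \<in> D \<Longrightarrow> i \<in> Z \<Longrightarrow> x i = 0" by (auto simp: Z_def code_support_def)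
  have "monom_vec Z c \<in> coord.span (monom_vec Z ` {c'. weight c' < weight c})" if "c \<in> {a, b}" for c
    using that leading_term_reducible[OF Z(1) Z(2)[OF D'(1)] ab(6,7)]
      leading_term_reducible[OF Z(1) Z(2)[OF D'(2)] ab(8,9)] by blast
  then have "card Z \<le> card (box - (\<Union>c\<in>{a, b}. quadrant c))" by (rule footprint_bound[OF Z(1)])
  also have "\<dots> = m - card (quadrant a \<union> quadrant b)"
  proof -
    have "quadrant a \<union> quadrant b \<subseteq> box" using quadrant_subset by blast
    then show ?thesis using card_Diff_subset[OF finite_subset[OF _ finite_box]] by (simp add: card_box)
  qed
  also have "card Z = m - card (code_support m D)"
    unfolding Z_def by (subst card_Diff_subset) (auto simp: code_support_def)
  finally have "m - card (code_support m D) \<le> m - card (quadrant a \<union> quadrant b)" .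
  moreover have "card (quadrant a \<union> quadrant b) \<le> m"
    unfolding card_box[symmetric] using quadrant_subset finite_box by (intro card_mono) auto
  ultimately have "card (quadrant a \<union> quadrant b) \<le> card (code_support m D)" by linarith
  then show thesis using that ab by (auto simp: B_def)
qed

lemma card_quadrants:
  assumes "\<forall>j\<in>{1..n}. a j < e j \<and> b j < e j"
  shows "int (card (quadrant a \<union> quadrant b)) = (\<Prod>j\<leftarrow>[1..<Suc n]. int (e j) - int (a j))
    + (\<Prod>j\<leftarrow>[1..<Suc n]. int (e j) - int (b j)) - (\<Prod>j\<leftarrow>[1..<Suc n]. int (e j) - int (max (a j) (b j)))"
proof -
  have c: "int (card (quadrant a)) = (\<Prod>j\<leftarrow>[1..<Suc n]. int (e j) - int (a j))" if "\<forall>j\<in>{1..n}. a j < e j" for a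
  proof -
    have "int (card (quadrant a)) = (\<Prod>j\<in>{1..n}. int (e j) - int (a j))"
      using that by (auto simp: quadrant_def card_PiE of_nat_diff less_imp_le intro!: prod.cong)
    also have "{1..n} = set [1..<Suc n]" by auto
    finally show ?thesis by (simp only: prod.distinct_set_conv_list[OF distinct_upt])
  qed
  have fin: "finite (quadrant a)" for a using quadrant_subset finite_box by (rule finite_subset)
  have "quadrant a \<inter> quadrant b = quadrant (\<lambda>j. max (a j) (b j))"
    by (auto simp: quadrant_def PiE_def Pi_def)
  then have "card (quadrant a \<union> quadrant b) + card (quadrant (\<lambda>j. max (a j) (b j))) = card (quadrant a) + card (quadrant b)"
    using card_Un_Int[OF fin[of a] fin[of b]] by simp
  then have "int (card (quadrant a \<union> quadrant b)) = int (card (quadrant a)) + int (card (quadrant b))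
     - int (card (quadrant (\<lambda>j. max (a j) (b j))))" by linarith
  then show ?thesis using c[of a] c[of b] c[of "\<lambda>j. max (a j) (b j)"] assms by simp
qed

section \<open>Codes supported on two quadrants\<close>

text \<open>The code is spanned by the two products of linear factors \<open>F a\<close> and \<open>F b\<close>. Since \<open>F c\<close> is nonzero
  exactly on the quadrant of \<open>c\<close>, proportional vectors would have equal quadrants, hence
  \<open>a\<close> and \<open>b\<close> would coincide.\<close>

lemma quadrants_attained:
  assumes ab: "\<forall>j\<in>{1..n}. a j < e j \<and> b j < e j" and ne: "\<exists>j\<in>{1..n}. a j \<noteq> b j"
    and deg: "deg a \<le> d" "deg b \<le> d"
  obtains D where "coord.subspace D" "coord.dim D = 2" "D \<subseteq> coord.span (monom_vec {1..m} ` {b. deg b \<le> d})"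
    "card (code_support m D) = card (quadrant a \<union> quadrant b)"
proof -
  have "\<exists>h. bij_betw h (A j) {..<e j}" if "j \<in> {1..n}" for j
    using ex_bij_betw_finite_nat[OF finite_A[OF that]] card_A[OF that] by (auto simp: atLeast0LessThan)
  then obtain h where h: "\<And>j. j \<in> {1..n} \<Longrightarrow> bij_betw (h j) (A j) {..<e j}" by metis
  define T where "T c j = {\<alpha> \<in> A j. h j \<alpha> < c j}" for c :: "nat \<Rightarrow> nat" and j
  define F where "F c = (\<lambda>i. if i \<in> {1..m} then \<Prod>j\<in>{1..n}. \<Prod>\<alpha>\<in>T c j. P i j - \<alpha> else 0)" for c
  \<comment> \<open>\<open>\<phi>\<close> identifies the points with the exponents of the box, and \<open>F c\<close> uses the factors
    that vanish below height \<open>c j\<close> in coordinate \<open>j\<close>.\<close>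
  define \<phi> where "\<phi> i = (\<lambda>j\<in>{1..n}. h j (P i j))" for i
  have cardT: "card (T c j) = c j" if "j \<in> {1..n}" "c j < e j" for c j
  proof -
    have "h j ` T c j = {..<c j}"
    proof
      show "{..<c j} \<subseteq> h j ` T c j"
      proof
        fix k assume "k \<in> {..<c j}"
        then have "k \<in> h j ` A j" using bij_betw_imp_surj_on[OF h[OF that(1)]] that(2) by simp
        then show "k \<in> h j ` T c j" using \<open>k \<in> {..<c j}\<close> by (auto simp: T_def)
      qed
    qed (auto simp: T_def)
    moreover have "inj_on (h j) (T c j)" 
      using bij_betw_imp_inj_on[OF h[OF that(1)]] by (rule inj_on_subset) (auto simp: T_def)
    ultimately show ?thesis using card_image[of "h j" "T c j"] by simp
  qed
  have F: "F c \<in> coord.span (monom_vec {1..m} ` {b. deg b \<le> d})" if "\<forall>j\<in>{1..n}. c j < e j" "deg c \<le> d" for c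
  proof -
    have "(\<Sum>j\<in>{1..n}. card (T c j)) = deg c" using cardT that by (simp add: deg_def)
    then have "F c \<in> coord.span (monom_vec {1..m} ` {b. deg b \<le> deg c})"
      unfolding F_def using span_linear_product[of "{1..n}" "T c" "{1..m}"] finite_A by (auto simp: T_def)
    then show ?thesis
      using coord.span_mono[of "monom_vec {1..m} ` {b. deg b \<le> deg c}" "monom_vec {1..m} ` {b. deg b \<le> d}"] that by fastforce
  qed
  have bij: "bij_betw \<phi> {1..m} box"
  proof (rule bij_betwI')
    fix i i' assume i: "i \<in> {1..m}" "i' \<in> {1..m}"
    have "i = i'" if "\<phi> i = \<phi> i'"
    proof -
      have "P i j = P i' j" if "j \<in> {1..n}" for j
      proof -
        have "h j (P i j) = h j (P i' j)" 
          using fun_cong[OF \<open>\<phi> i = \<phi> i'\<close>, of j] that by (simp add: \<phi>_def)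
        then show ?thesis using inj_onD[OF bij_betw_imp_inj_on[OF h[OF that]]] P_in i that by blast
      qed
      then have "restrict (P i) {1..n} = restrict (P i') {1..n}" by (rule restrict_ext)
      then show ?thesis using inj_onD[OF bij_betw_imp_inj_on[OF enum]] i by blast
    qed
    then show "(\<phi> i = \<phi> i') = (i = i')" by auto
  next
    fix i assume "i \<in> {1..m}"
    then have "h j (P i j) \<in> {..<e j}" if "j \<in> {1..n}" for j
      using bij_betwE[OF h[OF that]] P_in that by blast
    then show "\<phi> i \<in> box" unfolding \<phi>_def box_def by (intro restrict_PiE_iff[THEN iffD2]) blast
  next
    fix c assume c: "c \<in> box"
    define y where "y = (\<lambda>j\<in>{1..n}. inv_into (A j) (h j) (c j))"
    have y: "y j \<in> A j" "h j (y j) = c j" if "j \<in> {1..n}" for j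
    proof -
      have "c j \<in> {..<e j}" using c that unfolding box_def by (rule PiE_mem)
      then have "c j \<in> h j ` A j" using bij_betw_imp_surj_on[OF h[OF that]] by simp
      then show "y j \<in> A j" "h j (y j) = c j" using that by (simp_all add: y_def inv_into_into f_inv_into_f)
    qed
    have "y \<in> PiE {1..n} A" using y(1) by (intro PiE_I) (auto simp: y_def)
    then have "y \<in> (\<lambda>i. restrict (P i) {1..n}) ` {1..m}" using bij_betw_imp_surj_on[OF enum] by simp
    then obtain i where i: "i \<in> {1..m}" "restrict (P i) {1..n} = y" by blast
    have "\<phi> i = c"
    proof (rule PiE_ext)
      show "\<phi> i \<in> PiE {1..n} (\<lambda>_. UNIV)" by (simp add: \<phi>_def)
      show "c \<in> PiE {1..n} (\<lambda>_. UNIV)" using c unfolding box_def by (simp add: PiE_iff)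
      fix j assume j: "j \<in> {1..n}"
      then have "P i j = y j" using fun_cong[OF i(2), of j] by simp
      then show "\<phi> i j = c j" using y j by (simp add: \<phi>_def)
    qed
    then show "\<exists>i\<in>{1..m}. c = \<phi> i" using i by auto
  qed
  have Fnz: "F c i \<noteq> 0 \<longleftrightarrow> i \<in> {1..m} \<and> \<phi> i \<in> quadrant c" for c i
  proof (cases "i \<in> {1..m}")
    case True
    have "F c i \<noteq> 0 \<longleftrightarrow> (\<forall>j\<in>{1..n}. P i j \<notin> T c j)"
    proof -
      have "finite (T c j)" if "j \<in> {1..n}" for j using finite_A[OF that] by (simp add: T_def)
      then show ?thesis using True by (auto simp: F_def)
    qed
    also have "\<dots> \<longleftrightarrow> (\<forall>j\<in>{1..n}. c j \<le> \<phi> i j)"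
      using True P_in by (intro ball_cong refl) (simp add: T_def \<phi>_def not_less)
    also have "\<dots> \<longleftrightarrow> \<phi> i \<in> quadrant c"
    proof -
      have "\<phi> i \<in> box" using bij_betwE[OF bij] True by blast
      then show ?thesis by (simp add: quadrant_def box_def PiE_iff Ball_def)
    qed
    finally show ?thesis using True by simp
  next
    case False
    then have "F c i = 0" unfolding F_def by (rule if_not_P)
    then show ?thesis using False by blast
  qed
  have inq: "restrict c {1..n} \<in> quadrant c' \<longleftrightarrow> (\<forall>j\<in>{1..n}. c' j \<le> c j)"
    if "\<forall>j\<in>{1..n}. c j < e j" for c c' :: "nat \<Rightarrow> nat"
    using that by (simp add: quadrant_def PiE_iff)
  have hit: "\<exists>i\<in>{1..m}. \<phi> i = restrict c {1..n}" if "\<forall>j\<in>{1..n}. c j < e j" for c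
  proof -
    have "restrict c {1..n} \<in> \<phi> ` {1..m}" using bij_betw_imp_surj_on[OF bij] restrict_in_box[OF that] by simp
    then show ?thesis by force
  qed
  have scale: "\<forall>j\<in>{1..n}. c' j \<le> c j" if "F c = vscale k (F c')" and c: "\<forall>j\<in>{1..n}. c j < e j" for c c' k
  proof -
    obtain i where i: "i \<in> {1..m}" "\<phi> i = restrict c {1..n}" using hit[OF c] by auto
    then have "F c i \<noteq> 0" using Fnz[of c i] inq[OF c, of c] by simp
    then have "F c' i \<noteq> 0" using that(1) by (auto simp: vscale_def)
    then show ?thesis using Fnz[of c' i] inq[OF c, of c'] i by simp
  qed
  have nb: "F b \<noteq> vscale k (F a)" for k
  proof
    assume eq: "F b = vscale k (F a)"
    have "F b \<noteq> 0"
    proof -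
      obtain i where "i \<in> {1..m}" "\<phi> i = restrict b {1..n}" using hit[of b] ab by auto
      then have "F b i \<noteq> 0" using Fnz[of b i] inq[of b b] ab by simp
      then show ?thesis by auto
    qed
    then have "k \<noteq> 0" using eq by auto
    then have "F a = vscale (inverse k) (F b)" using eq by simp
    then have "\<forall>j\<in>{1..n}. b j \<le> a j" using ab by (intro scale) auto
    moreover have "\<forall>j\<in>{1..n}. a j \<le> b j" using eq ab by (intro scale) auto
    ultimately show False using ne by (meson le_antisym)
  qed
  have na: "F a \<noteq> 0"
  proof -
    obtain i where "i \<in> {1..m}" "\<phi> i = restrict a {1..n}" using hit[of a] ab by auto
    then have "F a i \<noteq> 0" using Fnz[of a i] inq[of a a] ab by simp
    then show ?thesis by auto
  qed
  define D where "D = coord.span {F a, F b}"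
  have ind: "coord.independent {F b, F a}"
  proof -
    have "F b \<notin> coord.span {F a}" using nb by (auto simp: coord.span_singleton)
    then show ?thesis using na by (simp add: coord.independent_insert)
  qed
  have nab: "F a \<noteq> F b" using nb[of 1] by auto
  have "coord.dim D = card {F b, F a}"
    unfolding D_def coord.dim_span using ind by (simp add: coord.dim_eq_card_independent insert_commute)
  then have dim: "coord.dim D = 2" using nab by auto
  have sub: "D \<subseteq> coord.span (monom_vec {1..m} ` {b. deg b \<le> d})"
    unfolding D_def using F ab deg by (intro coord.span_minimal coord.subspace_span) auto
  have zero: "\<forall>x\<in>D. x i = 0" if "F a i = 0" "F b i = 0" for i
  proof -
    have "coord.subspace {x :: nat \<Rightarrow> 'a. x i = 0}" by (auto simp: coord.subspace_def vscale_def)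
    then have "D \<subseteq> {x. x i = 0}" unfolding D_def using that by (intro coord.span_minimal) auto
    then show ?thesis by auto
  qed
  have "F a \<in> D" "F b \<in> D" by (auto simp: D_def intro: coord.span_base)
  then have "code_support m D = {i \<in> {1..m}. F a i \<noteq> 0 \<or> F b i \<noteq> 0}"
    using zero by (auto simp: code_support_def)
  also have "\<dots> = {i \<in> {1..m}. \<phi> i \<in> quadrant a \<union> quadrant b}" using Fnz by auto
  finally have supp: "code_support m D = {i \<in> {1..m}. \<phi> i \<in> quadrant a \<union> quadrant b}" .
  have "\<phi> ` code_support m D = quadrant a \<union> quadrant b"
  proof -
    have "quadrant a \<union> quadrant b \<subseteq> \<phi> ` {1..m}"
      using bij_betw_imp_surj_on[OF bij] quadrant_subset by blast
    then show ?thesis unfolding supp by blast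
  qed
  moreover have "inj_on \<phi> (code_support m D)"
    using bij_betw_imp_inj_on[OF bij] by (rule inj_on_subset) (auto simp: supp)
  ultimately have "card (code_support m D) = card (quadrant a \<union> quadrant b)" using card_image by metis
  moreover have "coord.subspace D" unfolding D_def by (rule coord.subspace_span)
  ultimately show thesis using that dim sub by blast
qed

text \<open>The support of every subcode is at least as large as the union for some admissible pair of exponents, and a pair
  with the smallest union is realised by a subcode.\<close>

lemma min_support:
  assumes "n \<ge> 1" and "\<forall>j\<in>{1..n}. 2 \<le> e j" and "sorted (map e [1..<Suc n])" and "1 \<le> d"
    and C: "C = coord.span (monom_vec {1..m} ` {b. deg b \<le> d})"
  shows "int (gen_hamming_weight m C 2) = union_min (map e [1..<Suc n]) d"
proof -
  define js where "js = [1..<Suc n]"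
  have js: "set js = {1..n}" "distinct js" "js \<noteq> []" using \<open>n \<ge> 1\<close> by (auto simp: js_def)
  have sorted: "sorted (map e js)" using assms(3) by (simp only: js_def)
  have deg_js: "deg b = sum_list (map b js)" for b
    unfolding deg_def js(1)[symmetric] using js(2) by (simp add: sum.distinct_set_conv_list)
  define W where "W = {card (code_support m D) | D. D \<subseteq> C \<and> coord.subspace D \<and> coord.dim D = 2}"
  have "W \<subseteq> {..m}"
  proof
    fix w assume "w \<in> W"
    then obtain D :: "(nat \<Rightarrow> 'a) set" where "w = card (code_support m D)" unfolding W_def by blast
    also have "\<dots> \<le> card {1..m}" by (intro card_mono) (auto simp: code_support_def)
    finally show "w \<in> {..m}" by simp
  qed
  then have "finite W" by (rule finite_subset) simp
  have lower: "union_min (map e js) d \<le> int w" if "w \<in> W" for w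
  proof -
    obtain D where D: "w = card (code_support m D)" "D \<subseteq> C" "coord.subspace D" "coord.dim D = 2"
      using \<open>w \<in> W\<close> unfolding W_def by blast
    obtain a b where ab: "a \<in> box" "b \<in> box" "a \<noteq> b" "deg a \<le> d" "deg b \<le> d"
      "card (quadrant a \<union> quadrant b) \<le> w"
      using support_ge_quadrants[OF D(3,4) D(2)[unfolded C]] D(1) by blast
    have lt: "\<forall>j\<in>{1..n}. a j < e j \<and> b j < e j" using ab unfolding box_def by auto
    have ne: "\<exists>j\<in>{1..n}. a j \<noteq> b j" using ab(1-3) unfolding box_def by (metis PiE_ext)
    have "union_min (map e js) d \<le> int (card (quadrant a \<union> quadrant b))"
      unfolding card_quadrants[OF lt] js_def[symmetric]
      using sorted
      by (rule union_min_le) (use lt ne ab(4,5) \<open>1 \<le> d\<close> in \<open>simp_all only: js(1) deg_js\<close>)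
    then show ?thesis using ab by linarith
  qed
  obtain a b where ab: "\<forall>j\<in>set js. a j < e j \<and> b j < e j" "sum_list (map a js) \<le> d" "sum_list (map b js) \<le> d"
    "\<exists>j\<in>set js. a j \<noteq> b j"
    "(\<Prod>j\<leftarrow>js. int (e j) - int (a j)) + (\<Prod>j\<leftarrow>js. int (e j) - int (b j))
      - (\<Prod>j\<leftarrow>js. int (e j) - int (max (a j) (b j))) = union_min (map e js) d"
    using union_min_attained[of js e d] assms js by auto
  obtain D where D: "coord.subspace D" "coord.dim D = 2" "D \<subseteq> C"
    "card (code_support m D) = card (quadrant a \<union> quadrant b)"
    unfolding C by (rule quadrants_attained[of a b d]) (use ab in \<open>simp_all only: deg_js js(1)\<close>)
  have "int (card (quadrant a \<union> quadrant b)) = union_min (map e js) d"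
    using card_quadrants[of a b] ab unfolding js(1) js_def[symmetric] by simp
  moreover have "card (quadrant a \<union> quadrant b) \<in> W" unfolding W_def D(4)[symmetric] using D(1-3) by blast
  ultimately have "\<exists>w\<in>W. int w = union_min (map e js) d" by blast
  then obtain w where w: "w \<in> W" "int w = union_min (map e js) d" by blast
  have "w \<le> w'" if "w' \<in> W" for w' using lower[OF that] w(2) by simp
  then have "Min W = w" using w(1) \<open>finite W\<close> by (intro Min_eqI) auto
  then show ?thesis using w(2) by (simp only: gen_hamming_weight_def W_def js_def)
qed

end

section \<open>Forms of degree $d$ and polynomials of degree at most $d$\<close>

lemma poly_eval_superset:
  assumes "finite T" and "Poly_Mapping.keys f \<subseteq> T"
  shows "poly_eval f x = (\<Sum>t\<in>T. Poly_Mapping.lookup f t * (\<Prod>i\<in>Poly_Mapping.keys t. x i ^ Poly_Mapping.lookup t i))"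
  unfolding poly_eval_def using assms by (intro sum.mono_neutral_left) (auto simp: in_keys_iff)

lemma poly_eval_add: "poly_eval (f + g) x = poly_eval f x + poly_eval g x"
proof -
  define T where "T = Poly_Mapping.keys f \<union> Poly_Mapping.keys g"
  have T: "finite T" "Poly_Mapping.keys (f + g) \<subseteq> T" "Poly_Mapping.keys f \<subseteq> T" "Poly_Mapping.keys g \<subseteq> T"
    using Poly_Mapping.keys_add[of f g] by (auto simp: T_def)
  show ?thesis
    unfolding T(2-4)[THEN poly_eval_superset[OF T(1)]] lookup_add distrib_right sum.distrib ..
qed

lemma poly_eval_single:
  "poly_eval (Poly_Mapping.single t c) x = c * (\<Prod>i\<in>Poly_Mapping.keys t. x i ^ Poly_Mapping.lookup t i)"
  using poly_eval_superset[of "{t}" "Poly_Mapping.single t c" x] by simp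

lemma homogeneous_part_add:
  assumes "f \<in> homogeneous_part s d" and "g \<in> homogeneous_part s d"
  shows "f + g \<in> homogeneous_part s d"
  using assms Poly_Mapping.keys_add[of f g] unfolding homogeneous_part_def by blast

text \<open>Setting the last variable to 1 turns forms of degree \<open>d\<close> into polynomials of degree at most
  \<open>d\<close> in the other variables, and homogenisation undoes this.\<close>

lemma (in cartesian_grid) eval_code_eq_span:
  assumes last: "\<And>i. i \<in> {1..m} \<Longrightarrow> P i (Suc n) = 1"
  shows "eval_code (Suc n) m P d = coord.span (monom_vec {1..m} ` {b. deg b \<le> d})"
proof
  have eval_term: "(\<Prod>j\<in>Poly_Mapping.keys t. P i j ^ Poly_Mapping.lookup t j) = monom_vec {1..m} (Poly_Mapping.lookup t) i"
    if "Poly_Mapping.keys t \<subseteq> {1..Suc n}" and i: "i \<in> {1..m}" for t i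
  proof -
    have "(\<Prod>j\<in>Poly_Mapping.keys t. P i j ^ Poly_Mapping.lookup t j) = (\<Prod>j=1..Suc n. P i j ^ Poly_Mapping.lookup t j)"
      using that(1) by (intro prod.mono_neutral_left) (auto simp: in_keys_iff)
    also have "\<dots> = (\<Prod>j=1..n. P i j ^ Poly_Mapping.lookup t j)" using last[OF i] by simp
    finally show ?thesis using i by (simp add: monom_vec_def)
  qed
  have size: "(\<Sum>j\<in>Poly_Mapping.keys t. Poly_Mapping.lookup t j) = deg (Poly_Mapping.lookup t) + Poly_Mapping.lookup t (Suc n)"
    if "Poly_Mapping.keys t \<subseteq> {1..Suc n}" for t
  proof -
    have "(\<Sum>j\<in>Poly_Mapping.keys t. Poly_Mapping.lookup t j) = (\<Sum>j=1..Suc n. Poly_Mapping.lookup t j)"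
      using that by (intro sum.mono_neutral_left) (auto simp: in_keys_iff)
    then show ?thesis by (simp add: deg_def)
  qed
  show "eval_code (Suc n) m P d \<subseteq> coord.span (monom_vec {1..m} ` {b. deg b \<le> d})"
  proof
    fix x assume "x \<in> eval_code (Suc n) m P d"
    then obtain f where f: "f \<in> homogeneous_part (Suc n) d"
      and x: "x = (\<lambda>i. if i \<in> {1..m} then poly_eval f (P i) else 0)" by (auto simp: eval_code_def)
    have t: "Poly_Mapping.keys t \<subseteq> {1..Suc n}" "deg (Poly_Mapping.lookup t) \<le> d"
      if "t \<in> Poly_Mapping.keys f" for t
    proof -
      show keys: "Poly_Mapping.keys t \<subseteq> {1..Suc n}" using f that unfolding homogeneous_part_def by blast
      have "(\<Sum>j\<in>Poly_Mapping.keys t. Poly_Mapping.lookup t j) = d"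
        using f that unfolding homogeneous_part_def by blast
      then show "deg (Poly_Mapping.lookup t) \<le> d" using size[OF keys] by linarith
    qed
    have "x = (\<Sum>t\<in>Poly_Mapping.keys f. vscale (Poly_Mapping.lookup f t) (monom_vec {1..m} (Poly_Mapping.lookup t)))"
    proof
      fix i
      show "x i = (\<Sum>t\<in>Poly_Mapping.keys f. vscale (Poly_Mapping.lookup f t) (monom_vec {1..m} (Poly_Mapping.lookup t))) i"
      proof (cases "i \<in> {1..m}")
        case True
        then have "x i = poly_eval f (P i)" by (simp add: x)
        also have "\<dots> = (\<Sum>t\<in>Poly_Mapping.keys f. Poly_Mapping.lookup f t * monom_vec {1..m} (Poly_Mapping.lookup t) i)"
          unfolding poly_eval_def using eval_term[OF t(1) True] by (intro sum.cong) simp_all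
        finally show ?thesis by (simp add: sum_apply vscale_def)
      next
        case False
        then have "x i = 0" unfolding x by (rule if_not_P)
        then show ?thesis unfolding sum_apply vscale_def monom_vec_def if_not_P[OF False] by simp
      qed
    qed
    then show "x \<in> coord.span (monom_vec {1..m} ` {b. deg b \<le> d})"
      by (simp only:) (intro coord.span_sum coord.span_scale coord.span_base imageI, simp add: t(2))
  qed
  show "coord.span (monom_vec {1..m} ` {b. deg b \<le> d}) \<subseteq> eval_code (Suc n) m P d"
  proof
    fix x assume "x \<in> coord.span (monom_vec {1..m} ` {b. deg b \<le> d})"
    then show "x \<in> eval_code (Suc n) m P d"
    proof (induction rule: coord.span_induct_alt)
      case base
      have "0 \<in> homogeneous_part (Suc n) d" by (simp add: homogeneous_part_def)
      moreover have "(0 :: nat \<Rightarrow> 'a) = (\<lambda>i. if i \<in> {1..m} then poly_eval 0 (P i) else 0)"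
        by (rule ext) (simp add: poly_eval_def)
      ultimately show ?case unfolding eval_code_def by (rule rev_image_eqI)
    next
      case (step c x y)
      obtain b where b: "x = monom_vec {1..m} b" "deg b \<le> d" using step by blast
      obtain g where g: "g \<in> homogeneous_part (Suc n) d"
        "y = (\<lambda>i. if i \<in> {1..m} then poly_eval g (P i) else 0)" using step by (auto simp: eval_code_def)
      \<comment> \<open>The last variable absorbs the missing degree; it is 1 at every point.\<close>
      define r where "r j = (if j \<in> {1..n} then b j else if j = Suc n then d - deg b else 0)" for j
      define t where "t = Abs_poly_mapping r"
      have "finite {j. r j \<noteq> 0}" by (rule finite_subset[of _ "{1..Suc n}"]) (auto simp: r_def)
      then have lt: "Poly_Mapping.lookup t = r" unfolding t_def by (rule lookup_Abs_poly_mapping)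
      then have keys: "Poly_Mapping.keys t \<subseteq> {1..Suc n}" 
      proof (intro subsetI)
        fix j assume "j \<in> Poly_Mapping.keys t"
        then have "r j \<noteq> 0" by (simp add: in_keys_iff lt)
        then show "j \<in> {1..Suc n}" by (auto simp: r_def split: if_splits)
      qed
      have rb: "r j = b j" if "j \<in> {1..n}" for j using that by (simp add: r_def)
      have "deg r = deg b" using rb by (rule deg_cong)
      then have "(\<Sum>j\<in>Poly_Mapping.keys t. Poly_Mapping.lookup t j) = d"
        using size[OF keys] b(2) by (simp add: lt r_def)
      then have "Poly_Mapping.single t c \<in> homogeneous_part (Suc n) d"
        using keys by (simp add: homogeneous_part_def)
      then have "Poly_Mapping.single t c + g \<in> homogeneous_part (Suc n) d"
        using g(1) by (rule homogeneous_part_add)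
      moreover have "vscale c x + y = (\<lambda>i. if i \<in> {1..m} then poly_eval (Poly_Mapping.single t c + g) (P i) else 0)"
      proof
        fix i
        have x: "x = monom_vec {1..m} r" unfolding b(1) using rb by (intro monom_vec_cong) simp
        show "(vscale c x + y) i = (if i \<in> {1..m} then poly_eval (Poly_Mapping.single t c + g) (P i) else 0)"
        proof (cases "i \<in> {1..m}")
          case True
          then show ?thesis
            unfolding x g(2) poly_eval_add poly_eval_single eval_term[OF keys True]
            unfolding lt by (simp add: vscale_def)
        next
          case False
          then show ?thesis unfolding x g(2) vscale_def monom_vec_def plus_fun_def if_not_P[OF False] by simp
        qed
      qed
      ultimately show ?case unfolding eval_code_def by (rule rev_image_eqI)
    qed
  qed
qed

section \<open>Projective points with last coordinate 1\<close>

lemma proj_point_inject: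
  assumes "x \<in> coord_space s" "y \<in> coord_space s" and "x s = 1" "y s = 1"
    and "proj_point s x = proj_point s y"
  shows "x = (y :: nat \<Rightarrow> 'a::field)"
proof -
  have "x \<noteq> 0" using assms(3) by (metis zero_fun_apply zero_neq_one)
  then have "x \<in> proj_point s x"
    using equiv_class_self[OF equiv_proj_rel, of x s] assms(1) unfolding proj_point_def by blast
  then have "x \<in> proj_point s y" by (simp only: assms(5))
  then have "(y, x) \<in> proj_rel s" unfolding proj_point_def by blast
  then obtain c where c: "x = vscale c y" unfolding proj_rel_def by blast
  have "c = 1" using fun_cong[OF c, of s] assms(3,4) by (simp add: vscale_def)
  then show ?thesis using c by simp
qed

lemma cartesian_grid_of_points:
  fixes A :: "nat \<Rightarrow> 'a::{field,finite} set"
  assumes X: "bij_betw (\<lambda>i. proj_point (Suc n) (P i)) {1..m} (cartesian_points (Suc n) A)"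
    and rep: "\<And>i. i \<in> {1..m} \<Longrightarrow> P i \<in> coord_space (Suc n) \<and> P i (Suc n) = 1"
    and e: "\<And>i. i \<in> {1..n} \<Longrightarrow> e i = card (A i)"
  shows "cartesian_grid n m A e P"
proof
  fix j assume "j \<in> {1..n}"
  then show "finite (A j)" "e j = card (A j)" by (simp, rule e)
next
  show "bij_betw (\<lambda>i. restrict (P i) {1..n}) {1..m} (PiE {1..n} A)"
  proof (rule bij_betwI')
    fix i i' assume i: "i \<in> {1..m}" "i' \<in> {1..m}"
    have "i = i'" if eq: "restrict (P i) {1..n} = restrict (P i') {1..n}"
    proof -
      have "P i j = P i' j" for j
      proof -
        have "{1..Suc n} = insert (Suc n) {1..n}" by auto
        then consider "j \<in> {1..n}" | "j = Suc n" | "j \<notin> {1..Suc n}" by blast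
        then show ?thesis
        proof cases
          case 1
          then show ?thesis using fun_cong[OF eq, of j] by simp
        next
          case 2
          then show ?thesis using rep[OF i(1)] rep[OF i(2)] by metis
        next
          case 3
          then have "P i j = 0" "P i' j = 0"
            using rep[OF i(1)] rep[OF i(2)] unfolding coord_space_def by blast+
          then show ?thesis by (simp only:)
        qed
      qed
      then have "P i = P i'" by (rule ext)
      then have "proj_point (Suc n) (P i) = proj_point (Suc n) (P i')" by (rule arg_cong)
      then show ?thesis using inj_onD[OF bij_betw_imp_inj_on[OF X]] i by blast
    qed
    then show "(restrict (P i) {1..n} = restrict (P i') {1..n}) = (i = i')" by blast
  next
    fix i assume i: "i \<in> {1..m}"
    then have "proj_point (Suc n) (P i) \<in> cartesian_points (Suc n) A" using bij_betwE[OF X] by blast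
    then obtain x where x: "proj_point (Suc n) (P i) = proj_point (Suc n) x" "x \<in> coord_space (Suc n)"
      "\<forall>j\<in>{1..n}. x j \<in> A j" "x (Suc n) = 1"
      unfolding cartesian_points_def diff_Suc_1 by blast
    have "P i = x" 
      using proj_point_inject[OF conjunct1[OF rep[OF i]] x(2) conjunct2[OF rep[OF i]] x(4) x(1)] .
    then show "restrict (P i) {1..n} \<in> PiE {1..n} A" using x(3) by simp
  next
    fix y assume y: "y \<in> PiE {1..n} A"
    define x where "x j = (if j \<in> {1..n} then y j else if j = Suc n then 1 else 0)" for j
    have x: "x \<in> coord_space (Suc n)" "x (Suc n) = 1" "\<And>j. j \<in> {1..n} \<Longrightarrow> x j = y j"
      by (simp_all add: x_def coord_space_def)
    have "\<forall>j\<in>{1..n}. x j \<in> A j" using x(3) PiE_mem[OF y] by simp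
    then have "proj_point (Suc n) x \<in> cartesian_points (Suc n) A"
      using x(1,2) unfolding cartesian_points_def diff_Suc_1 by blast
    then obtain i where i: "i \<in> {1..m}" "proj_point (Suc n) (P i) = proj_point (Suc n) x"
      unfolding bij_betw_imp_surj_on[OF X, symmetric] by (metis imageE)
    have "P i = x" 
      using proj_point_inject[OF conjunct1[OF rep[OF i(1)]] x(1) conjunct2[OF rep[OF i(1)]] x(2) i(2)] .
    moreover have "restrict x {1..n} = y"
    proof (rule PiE_ext[of _ "{1..n}" A])
      show "restrict x {1..n} \<in> PiE {1..n} A" using x(3) PiE_mem[OF y] by simp
      show "y \<in> PiE {1..n} A" by (rule y)
      show "restrict x {1..n} j = y j" if "j \<in> {1..n}" for j using x(3)[OF that] that by simp
    qed
    ultimately show "\<exists>i\<in>{1..m}. y = restrict (P i) {1..n}" using i(1) by blast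
  qed
qed

section \<open>The closed formula\<close>

lemma prod_list_map_upt:
  assumes "1 \<le> s"
  shows "int (prod_list (map e [a..<s])) = (\<Prod>i=a..s-1. int (e i))"
proof -
  have "{a..s-1} = set [a..<s]" using assms by auto
  then have "(\<Prod>i=a..s-1. e i) = prod_list (map e [a..<s])"
    by (simp only: prod.distinct_set_conv_list[OF distinct_upt])
  then show ?thesis by (simp flip: of_nat_prod)
qed

lemma ex1_block_iff:
  fixes e :: "nat \<Rightarrow> nat"
  assumes "2 \<le> s" and "1 \<le> d"
  shows "(\<exists>!(k, l). k + 2 \<le> s \<and> d = (\<Sum>i=1..k. (e i - 1)) + l \<and> 1 \<le> l \<and> l \<le> e (k+1) - 1)
    \<longleftrightarrow> d \<le> (\<Sum>i=1..s-1. (e i - 1))"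
proof -
  define S where "S k = (\<Sum>i=1..k. (e i - 1))" for k
  have S_Suc: "S (Suc k) = S k + (e (k + 1) - 1)" for k by (simp add: S_def)
  have mono: "S k \<le> S k'" if "k \<le> k'" for k k'
    using that by (induction rule: dec_induct) (auto simp: S_Suc)
  have block: "S k < d \<and> d \<le> S (Suc k)" if "d = S k + l" "1 \<le> l" "l \<le> e (k + 1) - 1" for k l
    using that unfolding S_Suc by linarith
  have "(\<exists>!(k, l). k + 2 \<le> s \<and> d = S k + l \<and> 1 \<le> l \<and> l \<le> e (k+1) - 1) \<longleftrightarrow> d \<le> S (s - 1)"
  proof
    assume "\<exists>!(k, l). k + 2 \<le> s \<and> d = S k + l \<and> 1 \<le> l \<and> l \<le> e (k+1) - 1"
    then obtain k l where kl: "k + 2 \<le> s" "d = S k + l" "1 \<le> l" "l \<le> e (k+1) - 1" by auto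
    have "d \<le> S (Suc k)" using block[OF kl(2-4)] by blast
    also have "\<dots> \<le> S (s - 1)" using kl(1) by (intro mono) linarith
    finally show "d \<le> S (s - 1)" .
  next
    assume d: "d \<le> S (s - 1)"
    define k' where "k' = (LEAST k. d \<le> S k)"
    have k': "d \<le> S k'" "k' \<le> s - 1" unfolding k'_def by (rule LeastI, rule d) (rule Least_le, rule d)
    have "S 0 = 0" by (simp add: S_def)
    then obtain k where k: "k' = Suc k" using k'(1) \<open>1 \<le> d\<close> by (cases k') auto
    have "S k < d" using not_less_Least[of k "\<lambda>k. d \<le> S k"] k by (simp add: k'_def)
    then have ex: "k + 2 \<le> s \<and> d = S k + (d - S k) \<and> 1 \<le> d - S k \<and> d - S k \<le> e (k+1) - 1"
      using k k' S_Suc[of k] \<open>2 \<le> s\<close> by auto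
    have uniq: "j = k \<and> l = d - S k" if "d = S j + l" "1 \<le> l" "l \<le> e (j + 1) - 1" for j l
    proof -
      have "S j < d" "d \<le> S (Suc j)" "S k < d" "d \<le> S (Suc k)"
        using block[OF that] k k' \<open>S k < d\<close> by auto
      then have "\<not> Suc j \<le> k" "\<not> Suc k \<le> j" using mono[of "Suc j" k] mono[of "Suc k" j] by auto
      then have "j = k" by simp
      then show ?thesis using that by simp
    qed
    show "\<exists>!(k, l). k + 2 \<le> s \<and> d = S k + l \<and> 1 \<le> l \<and> l \<le> e (k+1) - 1"
    proof (rule ex1I[of _ "(k, d - S k)"])
      show "case (k, d - S k) of (k, l) \<Rightarrow> k + 2 \<le> s \<and> d = S k + l \<and> 1 \<le> l \<and> l \<le> e (k+1) - 1"
        using ex by simp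
      fix p assume "case p of (k, l) \<Rightarrow> k + 2 \<le> s \<and> d = S k + l \<and> 1 \<le> l \<and> l \<le> e (k+1) - 1"
      then show "p = (k, d - S k)" using uniq by (cases p) auto
    qed
  qed
  then show ?thesis by (simp only: S_def)
qed

theorem theorem9p3:
  fixes A :: "nat \<Rightarrow> 'a::{field,finite} set"
    and X :: "(nat \<Rightarrow> 'a) set set"
    and P :: "nat \<Rightarrow> nat \<Rightarrow> 'a"
    and e :: "nat \<Rightarrow> nat"
    and s d m :: nat
  assumes s: "s \<ge> 2"
    and X: "X = cartesian_points s A"
    and m: "m = card X"
    and P_enum: "bij_betw (\<lambda>i. proj_point s (P i)) {1..m} X"
    and P_rep: "\<And>i. i \<in> {1..m} \<Longrightarrow> P i \<in> coord_space s \<and> P i s = 1"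
    and e: "\<And>i. i \<in> {1..s-1} \<Longrightarrow> e i = card (A i)"
    and e_ge: "2 \<le> e 1"
    and e_mono: "\<And>i j. 1 \<le> i \<Longrightarrow> i \<le> j \<Longrightarrow> j \<le> s - 1 \<Longrightarrow> e i \<le> e j"
    and d: "d \<ge> 1"
  shows
    "((\<exists>!(k, l). k + 2 \<le> s \<and> d = (\<Sum>i=1..k. (e i - 1)) + l \<and> 1 \<le> l \<and> l \<le> e (k+1) - 1)
        \<longleftrightarrow> d \<le> (\<Sum>i=1..s-1. (e i - 1)))
   \<and> (\<forall>k l. k + 2 \<le> s \<and> d = (\<Sum>i=1..k. (e i - 1)) + l \<and> 1 \<le> l \<and> l \<le> e (k+1) - 1 \<longrightarrow>
        (k + 3 < s \<longrightarrow>
           int (gen_hamming_weight m (eval_code s m P d) 2) =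
             (int (e (k+1)) - int l + 1) * (\<Prod>i=k+2..s-1. int (e i)) - (\<Prod>i=k+3..s-1. int (e i)))
      \<and> (k + 3 = s \<longrightarrow>
           int (gen_hamming_weight m (eval_code s m P d) 2) =
             (int (e (k+1)) - int l + 1) * (\<Prod>i=k+2..s-1. int (e i)) - 1)
      \<and> (k + 2 = s \<longrightarrow>
           int (gen_hamming_weight m (eval_code s m P d) 2) = int (e (s-1)) - int l + 1))
   \<and> (d \<ge> (\<Sum>i=1..s-1. (e i - 1)) \<longrightarrow> gen_hamming_weight m (eval_code s m P d) 2 = 2)"
proof -
  define n where "n = s - 1"
  have n: "s = Suc n" "1 \<le> n" using s by (auto simp: n_def)
  interpret cartesian_grid n m A e P
    using P_enum P_rep e unfolding X n(1) by (intro cartesian_grid_of_points) auto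
  have e2: "\<forall>j\<in>{1..n}. 2 \<le> e j"
  proof
    fix j assume "j \<in> {1..n}"
    then have "e 1 \<le> e j" using n(1) by (intro e_mono) auto
    then show "2 \<le> e j" using e_ge by simp
  qed
  have "sorted (map e [1..<Suc n])"
  proof (subst sorted_iff_nth_mono, intro allI impI)
    fix i j assume ij: "i \<le> j" "j < length (map e [1..<Suc n])"
    have "length (map e [1..<Suc n]) = n" by simp
    then have jn: "j < n" using ij(2) by (simp only:)
    have nth: "map e [1..<Suc n] ! i = e (1 + i)" if "i < n" for i
      using that by (simp del: upt_Suc)
    have "1 + j \<le> s - 1" using jn n(1) by simp
    then have "e (1 + i) \<le> e (1 + j)" using ij(1) by (intro e_mono) simp_all
    then show "map e [1..<Suc n] ! i \<le> map e [1..<Suc n] ! j"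
      unfolding nth[OF jn] nth[OF order.strict_trans1[OF ij(1) jn]] .
  qed
  then have sorted: "sorted (map e [1..<s])" by (simp only: n(1))
  have last: "P i (Suc n) = 1" if "i \<in> {1..m}" for i using P_rep[OF that] n(1) by (simp only:)
  have w: "int (gen_hamming_weight m (eval_code s m P d) 2) = union_min (map e [1..<s]) d"
    using min_support[OF n(2) e2 sorted[unfolded n(1)] d eval_code_eq_span[OF last]] by (simp only: n(1))
  have s1: "1 \<le> s" using s by simp
  have main: "int (gen_hamming_weight m (eval_code s m P d) 2) =
      (int (e (k+1)) - int l + 1) * (\<Prod>i=k+2..s-1. int (e i)) - int (corner (map e [k+2..<s]))"
    if kl: "k + 2 \<le> s \<and> d = (\<Sum>i=1..k. (e i - 1)) + l \<and> 1 \<le> l \<and> l \<le> e (k+1) - 1" for k l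
  proof -
    have "1 \<le> e i" if "i \<in> {1..k}" for i
    proof -
      have "i \<in> {1..n}" using that kl n(1) by auto
      then have "2 \<le> e i" using e2 by blast
      then show ?thesis by simp
    qed
    then have "union_min (map e [1..<s]) ((\<Sum>i=1..k. (e i - 1)) + l) =
      (int (e (k+1)) - int l + 1) * int (prod_list (map e [k+2..<s])) - int (corner (map e [k+2..<s]))"
      using kl by (intro union_min_eq) (blast | simp)+
    moreover have "d = (\<Sum>i=1..k. (e i - 1)) + l" using kl by blast
    ultimately show ?thesis unfolding w prod_list_map_upt[OF s1] by metis
  qed
  show ?thesis
  proof (intro conjI allI impI)
    show "(\<exists>!(k, l). k + 2 \<le> s \<and> d = (\<Sum>i=1..k. (e i - 1)) + l \<and> 1 \<le> l \<and> l \<le> e (k+1) - 1)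
        \<longleftrightarrow> d \<le> (\<Sum>i=1..s-1. (e i - 1))" using s d by (rule ex1_block_iff)
  next
    fix k l assume kl: "k + 2 \<le> s \<and> d = (\<Sum>i=1..k. (e i - 1)) + l \<and> 1 \<le> l \<and> l \<le> e (k+1) - 1" and k: "k + 3 < s"
    have "k + 2 < s" "Suc (k + 2) = k + 3" using k by simp_all
    then have "[k+2..<s] = (k + 2) # [k+3..<s]" by (metis upt_conv_Cons)
    then have "corner (map e [k+2..<s]) = prod_list (map e [k+3..<s])" by simp
    then show "int (gen_hamming_weight m (eval_code s m P d) 2) =
      (int (e (k+1)) - int l + 1) * (\<Prod>i=k+2..s-1. int (e i)) - (\<Prod>i=k+3..s-1. int (e i))"
      unfolding main[OF kl] prod_list_map_upt[OF s1, symmetric] by (simp only:)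
  next
    fix k l assume kl: "k + 2 \<le> s \<and> d = (\<Sum>i=1..k. (e i - 1)) + l \<and> 1 \<le> l \<and> l \<le> e (k+1) - 1" and k: "k + 3 = s"
    have "k + 2 < s" "s \<le> Suc (k + 2)" using k by simp_all
    then have "[k+2..<s] = [k + 2]" by (simp only: upt_conv_Cons upt_conv_Nil)
    then have "int (corner (map e [k+2..<s])) = 1" by simp
    then show "int (gen_hamming_weight m (eval_code s m P d) 2) =
      (int (e (k+1)) - int l + 1) * (\<Prod>i=k+2..s-1. int (e i)) - 1"
      unfolding main[OF kl] by (simp only:)
  next
    fix k l assume kl: "k + 2 \<le> s \<and> d = (\<Sum>i=1..k. (e i - 1)) + l \<and> 1 \<le> l \<and> l \<le> e (k+1) - 1" and k: "k + 2 = s"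
    have "[k+2..<s] = []" "{k+2..s-1} = {}" "k + 1 = s - 1" using k by auto
    then show "int (gen_hamming_weight m (eval_code s m P d) 2) = int (e (s-1)) - int l + 1"
      unfolding main[OF kl] by (simp only: list.map corner.simps prod.empty) simp
  next
    assume large: "d \<ge> (\<Sum>i=1..s-1. (e i - 1))"
    have set: "{1..s-1} = set [1..<s]" using s by auto
    have "(\<Sum>c\<leftarrow>map e [1..<s]. c - 1) = (\<Sum>i=1..s-1. (e i - 1))"
      by (simp only: set sum.distinct_set_conv_list[OF distinct_upt] map_map o_def)
    then have "(\<Sum>c\<leftarrow>map e [1..<s]. c - 1) \<le> d" using large by (simp only:)
    moreover have "\<forall>c\<in>set (map e [1..<s]). 2 \<le> c" using e2 n(1) by auto
    ultimately have "union_min (map e [1..<s]) d = 2" by (intro union_min_large)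
    then show "gen_hamming_weight m (eval_code s m P d) 2 = 2" using w by simp
  qed
qed

end
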